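(* For every $n\ge1$, the homology of the pointed ordered partition poset $\Pi_{PO}(n)$ with coefficients in $k$ is the $\mathbb{S}_n$-module $$H_l(\Pi_{PO}(n))\cong\begin{cases}k[Y_n]\otimes k[\mathbb{S}_n]&\text{if } l=n-1,\\0&\text{otherwise.}\end{cases}$$
   Context: $k$ denotes $\mathbb{Z}$, $\mathbb{Q}$, $\mathbb{F}_p$ or a field of characteristic $0$. An ordered partition of $[n]$ is a set of linearly ordered sequences of elements of $[n]$ giving a set partition of $[n]$ after forgetting the orders; $\mu$ is larger than $\lambda$ as ordered partitions if each block of $\lambda$ is the concatenation of an ordered sequence of blocks of $\mu$. A pointed ordered partition is an ordered partition in which exactly one element of each block is emphasized. In $\Pi_{PO}(n)$, $\lambda\le\mu$ iff the pointed elements of $\lambda$ are all pointed in $\mu$ and $\mu$ is larger than $\lambda$ as ordered partitions. $\mathbb{S}_n$ acts by relabelling. $H_l(\Pi)$ is the homology of the complex spanned by chains $\lambda_0<\cdots<\lambda_l$ with $\lambda_0$ minimal, $\lambda_l$ maximal, differential $\sum_{0<i<l}(-1)^id_i$, $d_i$ omitting $\lambda_i$. $Y_n$ is the set of planar binary trees with $n$ internal vertices; $k[Y_n]\otimes k[\mathbb{S}_n]$ is the arity-$n$ component of the dendriform operad $\mathcal{D}end$ (as $\mathbb{S}_n$-module, $\mathbb{S}_n$ acting on $k[\mathbb{S}_n]$). *)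

theory Defs
  imports "HOL-Combinatorics.Permutations" "HOL-Computational_Algebra.Primes"
begin

definition coeff_ring_ok :: "'k::comm_ring_1 itself \<Rightarrow> bool" where
  "coeff_ring_ok _ \<longleftrightarrow>
     bij (of_int :: int \<Rightarrow> 'k) \<or>
     ((\<forall>x::'k. x \<noteq> 0 \<longrightarrow> (\<exists>y. x * y = 1)) \<and>
      (inj (of_nat :: nat \<Rightarrow> 'k) \<or>
       (finite (UNIV :: 'k set) \<and> prime (card (UNIV :: 'k set)))))"

text \<open>A block is a linearly ordered sequence together with its pointed element.\<close>
type_synonym block = "nat list \<times> nat"
type_synonym ppart = "block set"

definition is_ppart :: "nat \<Rightarrow> ppart \<Rightarrow> bool" where
  "is_ppart n P \<longleftrightarrow> finite P \<and>
     (\<forall>(xs, p) \<in> P. xs \<noteq> [] \<and> distinct xs \<and> p \<in> set xs) \<and>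
     (\<forall>b1\<in>P. \<forall>b2\<in>P. b1 \<noteq> b2 \<longrightarrow> set (fst b1) \<inter> set (fst b2) = {}) \<and>
     (\<Union>b\<in>P. set (fst b)) = {1..n}"

definition PO :: "nat \<Rightarrow> ppart set" where
  "PO n = {P. is_ppart n P}"

definition po_le :: "ppart \<Rightarrow> ppart \<Rightarrow> bool" where
  "po_le P Q \<longleftrightarrow> snd ` P \<subseteq> snd ` Q \<and>
     (\<forall>(xs, p) \<in> P. \<exists>bs. set bs \<subseteq> fst ` Q \<and> concat bs = xs)"

definition po_less :: "ppart \<Rightarrow> ppart \<Rightarrow> bool" where
  "po_less P Q \<longleftrightarrow> po_le P Q \<and> P \<noteq> Q"

definition po_minimal :: "nat \<Rightarrow> ppart \<Rightarrow> bool" where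
  "po_minimal n P \<longleftrightarrow> P \<in> PO n \<and> \<not> (\<exists>Q\<in>PO n. po_less Q P)"

definition po_maximal :: "nat \<Rightarrow> ppart \<Rightarrow> bool" where
  "po_maximal n P \<longleftrightarrow> P \<in> PO n \<and> \<not> (\<exists>Q\<in>PO n. po_less P Q)"

definition chains :: "nat \<Rightarrow> nat \<Rightarrow> ppart list set" where
  "chains n l = {cs. length cs = Suc l \<and> set cs \<subseteq> PO n \<and>
       (\<forall>i<l. po_less (cs ! i) (cs ! Suc i)) \<and>
       po_minimal n (hd cs) \<and> po_maximal n (last cs)}"

text \<open>Chain group C_l: k-linear combinations of chains of length l (finitely many).\<close>
definition chain_group :: "nat \<Rightarrow> nat \<Rightarrow> (ppart list \<Rightarrow> 'k::comm_ring_1) set" where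
  "chain_group n l = {c. \<forall>cs. c cs \<noteq> 0 \<longrightarrow> cs \<in> chains n l}"

definition del_at :: "nat \<Rightarrow> 'a list \<Rightarrow> 'a list" where
  "del_at i xs = take i xs @ drop (Suc i) xs"

definition bdry :: "nat \<Rightarrow> nat \<Rightarrow> (ppart list \<Rightarrow> 'k::comm_ring_1) \<Rightarrow> (ppart list \<Rightarrow> 'k)" where
  "bdry n l c = (\<lambda>cs'. \<Sum>cs\<in>chains n l. \<Sum>i\<in>{1..<l}.
                    if del_at i cs = cs' then (-1) ^ i * c cs else 0)"

definition cycles :: "nat \<Rightarrow> nat \<Rightarrow> (ppart list \<Rightarrow> 'k::comm_ring_1) set" where
  "cycles n l = {c \<in> chain_group n l. bdry n l c = (\<lambda>_. 0)}"

definition boundaries :: "nat \<Rightarrow> nat \<Rightarrow> (ppart list \<Rightarrow> 'k::comm_ring_1) set" where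
  "boundaries n l = bdry n (Suc l) ` chain_group n (Suc l)"

definition perm_ppart :: "(nat \<Rightarrow> nat) \<Rightarrow> ppart \<Rightarrow> ppart" where
  "perm_ppart \<sigma> P = (\<lambda>(xs, p). (map \<sigma> xs, \<sigma> p)) ` P"

definition perm_chain :: "(nat \<Rightarrow> nat) \<Rightarrow> ppart list \<Rightarrow> ppart list" where
  "perm_chain \<sigma> cs = map (perm_ppart \<sigma>) cs"

definition act_C :: "(nat \<Rightarrow> nat) \<Rightarrow> (ppart list \<Rightarrow> 'k) \<Rightarrow> (ppart list \<Rightarrow> 'k)" where
  "act_C \<sigma> c = (\<lambda>cs. c (perm_chain (inv \<sigma>) cs))"

datatype pbtree = Leaf | Node pbtree pbtree

fun internal_vertices :: "pbtree \<Rightarrow> nat" where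
  "internal_vertices Leaf = 0"
| "internal_vertices (Node l r) = Suc (internal_vertices l + internal_vertices r)"

definition Y :: "nat \<Rightarrow> pbtree set" where
  "Y n = {t. internal_vertices t = n}"

text \<open>Free k-module on Y_n \<times> S_n; S_n acts by left multiplication on the S_n factor.\<close>
definition dend_module :: "nat \<Rightarrow> (pbtree \<times> (nat \<Rightarrow> nat) \<Rightarrow> 'k::comm_ring_1) set" where
  "dend_module n = {f. \<forall>x. f x \<noteq> 0 \<longrightarrow> fst x \<in> Y n \<and> snd x permutes {1..n}}"

definition act_D :: "(nat \<Rightarrow> nat) \<Rightarrow> (pbtree \<times> (nat \<Rightarrow> nat) \<Rightarrow> 'k) \<Rightarrow> (pbtree \<times> (nat \<Rightarrow> nat) \<Rightarrow> 'k)" where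
  "act_D \<sigma> f = (\<lambda>(t, \<tau>). f (t, inv \<sigma> \<circ> \<tau>))"

text \<open>An isomorphism of k[S_n]-modules Z_l/B_l \<cong> M, described on representatives:
  phi induces a well-defined bijection Z_l/B_l \<rightarrow> M (phi z1 = phi z2 iff z1 - z2 \<in> B_l,
  phi onto M), which is k-linear and S_n-equivariant.\<close>
definition homology_iso_to ::
  "nat \<Rightarrow> nat \<Rightarrow> ('m \<Rightarrow> 'k::comm_ring_1) set \<Rightarrow> ((nat \<Rightarrow> nat) \<Rightarrow> ('m \<Rightarrow> 'k) \<Rightarrow> ('m \<Rightarrow> 'k)) \<Rightarrow> bool" where
  "homology_iso_to n l M actM \<longleftrightarrow>
    (\<exists>\<phi> :: (ppart list \<Rightarrow> 'k) \<Rightarrow> ('m \<Rightarrow> 'k).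
       \<phi> ` cycles n l = M \<and>
       (\<forall>z1\<in>cycles n l. \<forall>z2\<in>cycles n l.
          \<phi> z1 = \<phi> z2 \<longleftrightarrow> (\<lambda>x. z1 x - z2 x) \<in> boundaries n l) \<and>
       (\<forall>z1\<in>cycles n l. \<forall>z2\<in>cycles n l.
          \<phi> (\<lambda>x. z1 x + z2 x) = (\<lambda>y. \<phi> z1 y + \<phi> z2 y)) \<and>
       (\<forall>a. \<forall>z\<in>cycles n l. \<phi> (\<lambda>x. a * z x) = (\<lambda>y. a * \<phi> z y)) \<and>
       (\<forall>\<sigma>. \<sigma> permutes {1..n} \<longrightarrow>
          (\<forall>z\<in>cycles n l. \<phi> (act_C \<sigma> z) = actM \<sigma> (\<phi> z))))"

end

(* Fix the word tau 1 ... tau n of a minimal element. A pointed ordered partition refining it is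
   determined by its set of pointed letters and its set of cuts between letters; coding letter i by
   2i - 1 and the cut after letter c by 2c turns these partitions into the subsets of {1..<2n} whose
   increasing enumeration alternates odd, even, ..., odd, ordered by inclusion. A cover adds a pair of
   elements, and every interval [x, y] has a distinguished atom, x plus the two smallest elements of
   y - x. Inserting or deleting the first such atom is a matching on chains, acyclic because the
   number of inversions between the steps of a chain strictly drops whenever a non-ascent is deleted.
   The unmatched (critical) chains are the maximal chains without ascents, so homology is concentrated in
   degree n - 1, where restriction to the unmatched chains is an isomorphism. In an unmatched chain
   each step adds the largest missing element together with a smaller partner; the partner splits the
   gap below it, and recording the splittings gives a planar binary tree. *)

theory Submission
  imports Defs
begin

section \<open>Chain complexes of lists and triangular systems\<close>

text \<open>A minimal element is one block, that is, a word with a chosen letter, and the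
  differential never removes an end of a chain. So the complex is a direct sum of copies of one
  complex, indexed by words, and the symmetric group permutes the words simply transitively: this is
  the factor k[S_n], and the copies carry no action of their own. A finer partition does not
  determine its word; a chain does, through its minimal end. Parity drives the combinatorics: a pair
  can be inserted into an alternating set only where no element lies between its two members, since
  the rank of such an element would change by one. The matching enters as linear algebra. The matrix
  between partners is triangular with signs on the diagonal, hence invertible over every commutative
  ring. Solvability and uniqueness give exactness outside the top degree; in the top degree they
  leave the values on critical chains free, with nothing to divide out. The root of the tree records
  the point of the minimal element: its subtrees count the letters before and after that
  point.\<close>

lemma del_at_simps [simp]:
  "del_at i [] = []" "del_at 0 (x # xs) = xs" "del_at (Suc i) (x # xs) = x # del_at i xs"
  by (auto simp: del_at_def)

lemma length_del_at: "i < length xs \<Longrightarrow> length (del_at i xs) = length xs - 1"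
  by (auto simp: del_at_def)

lemma map_del_at: "map f (del_at i xs) = del_at i (map f xs)"
  by (simp add: del_at_def take_map drop_map)

text \<open>The simplicial identity for deletions; it pairs off the terms of the squared
  boundary.\<close>

lemma del_at_del_at: "i \<le> j \<Longrightarrow> del_at j (del_at i xs) = del_at i (del_at (Suc j) xs)"
proof (induction xs arbitrary: i j)
  case (Cons x xs)
  show ?case
  proof (cases i)
    case 0
    then show ?thesis by (cases j) simp_all
  next
    case (Suc i')
    then obtain j' where j: "j = Suc j'" using Cons.prems by (cases j) auto
    show ?thesis using Cons.IH[of i' j'] Cons.prems unfolding Suc j by simp
  qed
qed simp

text \<open>In a list without repetitions the entry lost from its set identifies the deleted
  position. Hence a face arises in one way only and its incidence is a sign.\<close>

lemma del_at_inj: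
  assumes "distinct xs" "i < length xs" "j < length xs" "del_at i xs = del_at j xs"
  shows "i = j"
proof -
  have *: "set (del_at k xs) = set xs - {xs ! k}" if "k < length xs" for k
  proof -
    have "xs = take k xs @ xs ! k # drop (Suc k) xs" using that by (rule id_take_nth_drop)
    then have "distinct (take k xs @ xs ! k # drop (Suc k) xs)"
      "set xs = set (take k xs @ xs ! k # drop (Suc k) xs)" using assms(1) by metis+
    then show ?thesis by (auto simp: del_at_def)
  qed
  have "xs ! i = xs ! j" using *[of i] *[of j] assms nth_mem by fastforce
  then show ?thesis using assms nth_eq_iff_index_eq by blast
qed

section \<open>Incidence coefficients and the boundary operator on lists\<close>

definition supp_on :: "'a set \<Rightarrow> ('a \<Rightarrow> 'k::zero) \<Rightarrow> bool" where
  "supp_on X c \<longleftrightarrow> (\<forall>x. c x \<noteq> 0 \<longrightarrow> x \<in> X)"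

text \<open>Only inner positions occur: a list of length \<open>Suc l\<close> stands for a chain of
  length \<open>l\<close>, and its two ends are never deleted.\<close>

definition incidence :: "'a list \<Rightarrow> 'a list \<Rightarrow> 'k::comm_ring_1" where
  "incidence v u = (\<Sum>i\<in>{1..<length v - 1}. if del_at i v = u then (-1) ^ i else 0)"

definition boundary :: "'a list set \<Rightarrow> ('a list \<Rightarrow> 'k::comm_ring_1) \<Rightarrow> 'a list \<Rightarrow> 'k" where
  "boundary X c u = (\<Sum>v\<in>X. incidence v u * c v)"

lemma incidence_nonzeroE:
  assumes "(incidence v u :: 'k::comm_ring_1) \<noteq> 0"
  obtains i where "i \<in> {1..<length v - 1}" "del_at i v = u"
proof -
  from assms obtain i where "i \<in> {1..<length v - 1}"
      "(if del_at i v = u then (-1) ^ i else 0 :: 'k) \<noteq> 0"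
    unfolding incidence_def by (rule sum.not_neutral_contains_not_neutral)
  then show ?thesis by (intro that[of i]) (auto split: if_splits)
qed

lemma incidence_del_at:
  fixes v :: "'a list"
  assumes "distinct v" "i \<in> {1..<length v - 1}"
  shows "incidence v (del_at i v) = ((-1) ^ i :: 'k::comm_ring_1)"
proof -
  have "(incidence v (del_at i v) :: 'k) = (\<Sum>j\<in>{1..<length v - 1}. if j = i then (-1) ^ j else 0 :: 'k)"
    unfolding incidence_def by (rule sum.cong) (use assms del_at_inj[of v] in auto)
  then show ?thesis using assms by simp
qed

lemma boundary_cong: "(\<And>v. v \<in> X \<Longrightarrow> c v = c' v) \<Longrightarrow> boundary X c = boundary X c'"
  by (auto simp: boundary_def fun_eq_iff intro!: sum.cong)

lemma boundary_add: "boundary X (\<lambda>v. a v + b v) u = boundary X a u + boundary X b u"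
  by (simp add: boundary_def distrib_left sum.distrib)

lemma boundary_diff: "boundary X (\<lambda>v. a v - b v) u = boundary X a u - boundary X b u"
  by (simp add: boundary_def right_diff_distrib sum_subtractf)

text \<open>The map from \<open>(i, j)\<close> to \<open>(Suc j, i)\<close> exchanges the pairs with
  \<open>i \<le> j\<close> and those with \<open>j < i\<close>. It preserves \<open>g\<close> and
  shifts the exponent by one, so the terms cancel in pairs.\<close>

lemma alternating_double_sum:
  fixes g :: "nat \<Rightarrow> nat \<Rightarrow> 'k::comm_ring_1"
  assumes "\<And>i j. i \<le> j \<Longrightarrow> g i j = g (Suc j) i"
  shows "(\<Sum>i\<in>{1..<l}. \<Sum>j\<in>{1..<l - 1}. (-1) ^ (i + j) * g i j) = 0"
proof -
  let ?f = "\<lambda>(i, j). (-1) ^ (i + j) * g i j"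
  let ?P = "{1..<l} \<times> {1..<l - 1}"
  let ?A = "{p \<in> ?P. fst p \<le> snd p}" and ?B = "{p \<in> ?P. snd p < fst p}"
  have "sum ?f ?A = (\<Sum>p\<in>?B. - ?f p)"
  proof (rule sum.reindex_bij_witness[of _ "\<lambda>(i, j). (j, i - 1)" "\<lambda>(i, j). (Suc j, i)"])
    fix p assume p: "p \<in> ?A"
    then show "- ?f (case p of (i, j) \<Rightarrow> (Suc j, i)) = ?f p"
      using assms[of "fst p" "snd p"] by (cases p) (simp add: add.commute)
  qed auto
  then have "sum ?f ?A + sum ?f ?B = 0" by (simp add: sum_negf)
  moreover have "sum ?f (?A \<union> ?B) = sum ?f ?A + sum ?f ?B"
    by (rule sum.union_disjoint) auto
  moreover have "?A \<union> ?B = ?P" by auto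
  ultimately have "sum ?f ?P = 0" by simp
  then show ?thesis by (simp only: sum.cartesian_product)
qed

lemma boundary_boundary:
  fixes c :: "'a list \<Rightarrow> 'k::comm_ring_1"
  assumes "finite X'"
    and len: "\<And>v. v \<in> X \<Longrightarrow> length v = Suc l"
    and del: "\<And>v i. v \<in> X \<Longrightarrow> i \<in> {1..<l} \<Longrightarrow> del_at i v \<in> X'"
  shows "boundary X' (boundary X c) u = 0"
proof -
  have inner: "(\<Sum>w\<in>X'. incidence w u * incidence v w) = (0::'k)" if v: "v \<in> X" for v
  proof -
    have "(\<Sum>w\<in>X'. incidence w u * incidence v w)
        = (\<Sum>w\<in>X'. \<Sum>i\<in>{1..<l}. if w = del_at i v then incidence w u * (-1) ^ i else (0::'k))"
      unfolding incidence_def[of v] sum_distrib_left using len[OF v]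
      by (auto intro!: sum.cong)
    also have "\<dots> = (\<Sum>i\<in>{1..<l}. \<Sum>w\<in>X'. if w = del_at i v then incidence w u * (-1) ^ i else (0::'k))"
      by (rule sum.swap)
    also have "\<dots> = (\<Sum>i\<in>{1..<l}. incidence (del_at i v) u * (-1) ^ i)"
      using assms(1) del[OF v] by (intro sum.cong) auto
    also have "\<dots> = (\<Sum>i\<in>{1..<l}. \<Sum>j\<in>{1..<l - 1}.
        (-1) ^ (i + j) * (if del_at j (del_at i v) = u then 1 else 0))"
    proof (rule sum.cong)
      fix i assume i: "i \<in> {1..<l}"
      then have L: "length (del_at i v) - 1 = l - 1" using len[OF v] by (simp add: length_del_at)
      show "incidence (del_at i v) u * (-1) ^ i
        = (\<Sum>j\<in>{1..<l - 1}. (-1) ^ (i + j) * (if del_at j (del_at i v) = u then 1 else (0::'k)))"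
        unfolding incidence_def L sum_distrib_right by (rule sum.cong) (auto simp: power_add)
    qed simp
    also have "\<dots> = 0"
      by (rule alternating_double_sum) (simp add: del_at_del_at)
    finally show ?thesis .
  qed
  have "boundary X' (boundary X c) u = (\<Sum>v\<in>X. (\<Sum>w\<in>X'. incidence w u * incidence v w) * c v)"
    unfolding boundary_def sum_distrib_left sum_distrib_right
    by (subst sum.swap) (simp add: mult.assoc)
  then show ?thesis using inner by simp
qed

section \<open>Triangular linear systems over a commutative ring\<close>

lemma finite_set_max:
  fixes pot :: "'a \<Rightarrow> nat"
  assumes "finite U" "U \<noteq> {}"
  shows "\<exists>u0\<in>U. \<forall>u\<in>U. pot u \<le> pot u0"
proof -
  have "Max (pot ` U) \<in> pot ` U" using assms by simp
  then obtain u0 where u0: "u0 \<in> U" "Max (pot ` U) = pot u0" by auto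
  have "pot u \<le> Max (pot ` U)" if "u \<in> U" for u using assms that by simp
  then show ?thesis using u0 by auto
qed

text \<open>A row of maximal potential contains nothing but its diagonal entry, which is its own
  inverse; this fixes one unknown without division. Removing it leaves a smaller system of the same
  kind with a changed right-hand side.\<close>

lemma triangular_solvable:
  fixes M :: "'a \<Rightarrow> 'a \<Rightarrow> 'k::comm_ring_1" and pot :: "'a \<Rightarrow> nat"
  assumes "finite U" "\<And>u. u \<in> U \<Longrightarrow> M u u * M u u = 1"
    and "\<And>u u'. u \<in> U \<Longrightarrow> u' \<in> U \<Longrightarrow> u \<noteq> u' \<Longrightarrow> M u' u \<noteq> 0 \<Longrightarrow> pot u' < pot u"
  shows "\<exists>y. \<forall>u'\<in>U. (\<Sum>u\<in>U. M u' u * y u) = g u'"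
  using assms
proof (induction U arbitrary: g rule: finite_psubset_induct)
  case (psubset U)
  show ?case
  proof (cases "U = {}")
    case False
    then obtain u0 where u0: "u0 \<in> U" "\<And>u. u \<in> U \<Longrightarrow> pot u \<le> pot u0"
      using finite_set_max[OF psubset.hyps] by blast
    define a where "a = M u0 u0 * g u0"
    obtain y where y: "\<forall>u'\<in>U - {u0}. (\<Sum>u\<in>U - {u0}. M u' u * y u) = g u' - M u' u0 * a"
      using psubset.IH[of "U - {u0}" "\<lambda>u'. g u' - M u' u0 * a"] u0(1) psubset.prems by blast
    let ?y = "y(u0 := a)"
    have split: "(\<Sum>u\<in>U. M u' u * ?y u) = M u' u0 * a + (\<Sum>u\<in>U - {u0}. M u' u * y u)" for u'
      using psubset.hyps u0(1) by (subst sum.remove[of _ u0]) (auto intro!: sum.cong)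
    have "(\<Sum>u\<in>U - {u0}. M u0 u * y u) = 0"
    proof (rule sum.neutral, rule ballI)
      fix u assume u: "u \<in> U - {u0}"
      then have "M u0 u = 0" using psubset.prems(2)[of u u0] u0(1) u0(2)[of u] by (cases "M u0 u = 0") auto
      then show "M u0 u * y u = 0" by simp
    qed
    then have "(\<Sum>u\<in>U. M u0 u * ?y u) = g u0"
      using split[of u0] psubset.prems(1)[OF u0(1)] by (simp add: a_def mult.assoc[symmetric])
    moreover have "(\<Sum>u\<in>U. M u' u * ?y u) = g u'" if "u' \<in> U - {u0}" for u'
      unfolding split using y that by simp
    ultimately have "\<forall>u'\<in>U. (\<Sum>u\<in>U. M u' u * ?y u) = g u'" by blast
    then show ?thesis by (intro exI[of _ ?y])
  qed simp
qed

text \<open>Among the unknowns that are not zero take one of maximal potential: all other terms of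
  its row vanish, and the diagonal entry can be cancelled.\<close>

lemma triangular_unique:
  fixes M :: "'a \<Rightarrow> 'a \<Rightarrow> 'k::comm_ring_1" and pot :: "'a \<Rightarrow> nat"
  assumes "finite U" "\<And>u. u \<in> U \<Longrightarrow> M u u * M u u = 1"
    and "\<And>u u'. u \<in> U \<Longrightarrow> u' \<in> U \<Longrightarrow> u \<noteq> u' \<Longrightarrow> M u' u \<noteq> 0 \<Longrightarrow> pot u' < pot u"
    and "\<And>u'. u' \<in> U \<Longrightarrow> (\<Sum>u\<in>U. M u' u * y u) = 0" "u \<in> U"
  shows "y u = 0"
proof (rule ccontr)
  assume "y u \<noteq> 0"
  let ?Z = "{u \<in> U. y u \<noteq> 0}"
  have "finite ?Z" "?Z \<noteq> {}" using assms(1,5) \<open>y u \<noteq> 0\<close> by auto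
  then obtain u0 where u0: "u0 \<in> ?Z" "\<And>u. u \<in> ?Z \<Longrightarrow> pot u \<le> pot u0"
    using finite_set_max[of ?Z pot] by blast
  have "(\<Sum>u\<in>U - {u0}. M u0 u * y u) = 0"
  proof (rule sum.neutral, rule ballI)
    fix u assume u: "u \<in> U - {u0}"
    show "M u0 u * y u = 0"
    proof (cases "y u = 0")
      case False
      then have "pot u \<le> pot u0" "u \<in> U" "u0 \<in> U" "u \<noteq> u0" using u u0 by auto
      then have "M u0 u = 0" using assms(3)[of u u0] not_le by blast
      then show ?thesis by simp
    qed simp
  qed
  then have "M u0 u0 * y u0 = 0"
    using assms(4)[of u0] u0(1) sum.remove[OF assms(1), of u0 "\<lambda>u. M u0 u * y u"]
    by (metis (no_types, lifting) add.right_neutral mem_Collect_eq)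
  then have "(M u0 u0 * M u0 u0) * y u0 = 0" by (simp add: mult.assoc)
  moreover have "M u0 u0 * M u0 u0 = 1" "y u0 \<noteq> 0" using assms(2) u0(1) by auto
  ultimately show False by simp
qed

section \<open>Alternating sets and the matching on their chains\<close>

text \<open>Stated through the parity of ranks instead of an enumeration: the effect of inserting
  elements on a rank is a mere count, so admissible insertions can be decided by parity.\<close>

definition alternating :: "nat \<Rightarrow> nat set \<Rightarrow> bool" where
  "alternating n T \<longleftrightarrow> T \<subseteq> {1..<2 * n} \<and> odd (card T) \<and> (\<forall>t\<in>T. even (card {s \<in> T. s \<le> t} + t))"

lemma alternating_finite: "alternating n T \<Longrightarrow> finite T"
  unfolding alternating_def using finite_subset by blast

text \<open>The successor of \<open>u\<close> in \<open>T\<close> has rank one more than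
  \<open>u\<close>, hence the other parity.\<close>

lemma alternating_next:
  assumes "alternating n T" "u \<in> T" "v \<in> T" "u < v"
  shows "\<exists>t\<in>T. u < t \<and> t \<le> v \<and> odd (u + t)"
proof -
  have fin: "finite T" using assms(1) by (rule alternating_finite)
  let ?t = "Min {s \<in> T. u < s}"
  have ne: "{s \<in> T. u < s} \<noteq> {}" "finite {s \<in> T. u < s}" using assms fin by auto
  have "?t \<in> {s \<in> T. u < s}" by (rule Min_in[OF ne(2,1)])
  moreover have le: "?t \<le> s" if "s \<in> T" "u < s" for s using Min_le[OF ne(2)] that by blast
  ultimately have t: "?t \<in> T" "u < ?t" "?t \<le> v" using assms(3,4) by blast+
  have "s = ?t" if "s \<in> T" "s \<le> ?t" "\<not> s \<le> u" for s
    using le[of s] that by (simp only: not_le order.antisym)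
  then have "{s \<in> T. s \<le> ?t} = insert ?t {s \<in> T. s \<le> u}"
    using t(1,2) by (blast intro: less_imp_le order.trans)
  then have "card {s \<in> T. s \<le> ?t} = Suc (card {s \<in> T. s \<le> u})"
    using t fin by simp
  moreover have "even (card {s \<in> T. s \<le> ?t} + ?t)" "even (card {s \<in> T. s \<le> u} + u)"
    using assms t by (auto simp: alternating_def)
  ultimately have "odd (u + ?t)" by auto
  then show ?thesis using t by blast
qed

definition full :: "nat \<Rightarrow> nat set" where "full n = {1..<2 * n}"

lemma alternating_full: "n \<ge> 1 \<Longrightarrow> alternating n (full n)"
proof -
  have "{s \<in> {1..<2 * n}. s \<le> t} = {1..t}" if "t \<in> {1..<2*n}" for t using that by auto
  then show "n \<ge> 1 \<Longrightarrow> alternating n (full n)" by (auto simp: alternating_def full_def)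
qed

text \<open>Of the two new elements only \<open>a\<close> lies below such a \<open>t\<close>, so the
  rank of \<open>t\<close> would change by one while \<open>t\<close> keeps its parity.\<close>

lemma alternating_insert_pairD:
  assumes "alternating n T" "alternating n (T \<union> {a, b})" "a < b" "a \<notin> T" "t \<in> T"
  shows "\<not> (a < t \<and> t < b)"
proof
  assume t: "a < t \<and> t < b"
  have fin: "finite T" using assms(1) by (rule alternating_finite)
  have "{s \<in> T \<union> {a, b}. s \<le> t} = insert a {s \<in> T. s \<le> t}" using t assms by auto
  then have "card {s \<in> T \<union> {a, b}. s \<le> t} = Suc (card {s \<in> T. s \<le> t})" using fin assms by simp
  moreover have "even (card {s \<in> T \<union> {a, b}. s \<le> t} + t)" "even (card {s \<in> T. s \<le> t} + t)"
    using assms by (auto simp: alternating_def)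
  ultimately show False by simp
qed

text \<open>Elements above the pair gain two in rank and elements below it nothing, so only the
  parities of \<open>a\<close> and \<open>b\<close> themselves have to be right.\<close>

lemma alternating_insert_pair:
  assumes "alternating n T" "a < b" "b < 2 * n" "a \<notin> T" "b \<notin> T" "1 \<le> a"
    and "\<And>t. t \<in> T \<Longrightarrow> \<not> (a < t \<and> t < b)"
    and "odd (card {s \<in> T. s \<le> a} + a)" "odd (a + b)"
  shows "alternating n (T \<union> {a, b})"
  unfolding alternating_def
proof (intro conjI ballI)
  have fin: "finite T" using assms(1) by (rule alternating_finite)
  show "T \<union> {a, b} \<subseteq> {1..<2 * n}" using assms by (auto simp: alternating_def)
  have "card (T \<union> {a, b}) = card T + 2" using assms fin by (simp add: card_insert_if)
  then show "odd (card (T \<union> {a, b}))" using assms(1) by (simp add: alternating_def)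
  have A: "{s \<in> T \<union> {a, b}. s \<le> a} = insert a {s \<in> T. s \<le> a}" using assms by auto
  have B: "{s \<in> T \<union> {a, b}. s \<le> b} = insert b (insert a {s \<in> T. s \<le> a})"
  proof -
    have "s = b \<or> s = a \<or> s \<le> a" if "s \<in> T \<union> {a, b}" "s \<le> b" for s
      using assms(7)[of s] that by (cases "s \<in> T") (auto simp: not_less)
    then show ?thesis using assms(2) by (blast intro: less_imp_le order.trans)
  qed
  fix t assume "t \<in> T \<union> {a, b}"
  then consider "t = a" | "t = b" | "t \<in> T" "t < a" | "t \<in> T" "b < t"
    using assms by (metis Un_iff insert_iff linorder_neqE_nat singletonD)
  then show "even (card {s \<in> T \<union> {a, b}. s \<le> t} + t)"
  proof cases
    case 1
    then show ?thesis using A assms fin by simp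
  next
    case 2
    then show ?thesis using B assms fin by (simp add: card_insert_if)
  next
    case 3
    then have "{s \<in> T \<union> {a, b}. s \<le> t} = {s \<in> T. s \<le> t}" using assms by auto
    then show ?thesis using 3 assms(1) by (simp add: alternating_def)
  next
    case 4
    then have "{s \<in> T \<union> {a, b}. s \<le> t} = insert a (insert b {s \<in> T. s \<le> t})" using assms by auto
    then have "card {s \<in> T \<union> {a, b}. s \<le> t} = card {s \<in> T. s \<le> t} + 2"
      using fin assms by (simp add: card_insert_if)
    then show ?thesis using 4 assms(1) by (simp add: alternating_def)
  qed
qed

section \<open>The distinguished atom of an interval\<close>

definition ascent :: "nat set \<Rightarrow> nat set \<Rightarrow> nat set \<Rightarrow> bool" where
  "ascent x y z \<longleftrightarrow> (\<forall>s\<in>y - x. \<forall>t\<in>z - y. s < t)"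

definition first_atom :: "nat set \<Rightarrow> nat set \<Rightarrow> nat set" where
  "first_atom x y = x \<union> {Min (y - x), Min (y - x - {Min (y - x)})}"

lemma even_card_diff:
  assumes "alternating n x" "alternating n y" "x \<subset> y"
  shows "even (card (y - x))" "card (y - x) \<ge> 2"
proof -
  have fin: "finite x" "finite y" using assms alternating_finite by auto
  have "card (y - x) = card y - card x" "card x < card y"
    using assms fin by (auto simp: card_Diff_subset psubset_card_mono)
  then show e: "even (card (y - x))" using assms by (simp add: alternating_def)
  have "card (y - x) \<noteq> 0" using assms fin by auto
  then show "card (y - x) \<ge> 2" using e by (metis One_nat_def le_neq_implies_less less_2_cases_iff not_le odd_one)
qed

text \<open>Below the least new element \<open>a\<close> the sets \<open>x\<close> and
  \<open>y\<close> agree, and an element of \<open>x\<close> between \<open>a\<close> and the second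
  new element \<open>b\<close> would have ranks of different parity in \<open>x\<close> and in
  \<open>y\<close>. So \<open>a\<close> and \<open>b\<close> are neighbours in \<open>y\<close> with
  opposite parities, and both may be inserted into \<open>x\<close>.\<close>

lemma first_atom_props:
  assumes "alternating n x" "alternating n y" "x \<subset> y"
  shows "alternating n (first_atom x y)" "x \<subset> first_atom x y" "first_atom x y \<subseteq> y" "card (first_atom x y - x) = 2" "ascent x (first_atom x y) y"
proof -
  have fin: "finite x" "finite y" using assms alternating_finite by auto
  define a where "a = Min (y - x)"
  define b where "b = Min (y - x - {a})"
  have ne: "y - x \<noteq> {}" using assms by auto
  have a: "a \<in> y" "a \<notin> x" using Min_in[of "y - x"] ne fin a_def by auto
  have amin: "a \<le> t" if "t \<in> y" "t \<notin> x" for t using that fin a_def by simp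
  have "card (y - x - {a}) = card (y - x) - 1" using a fin by simp
  then have ne': "y - x - {a} \<noteq> {}" using even_card_diff(2)[OF assms] by (metis card.empty
      One_nat_def Suc_1 diff_is_0_eq not_less_eq_eq order_refl)
  have b: "b \<in> y" "b \<notin> x" "b \<noteq> a" using Min_in[OF _ ne'] fin b_def by auto
  have bmin: "b \<le> t" if "t \<in> y" "t \<notin> x" "t \<noteq> a" for t using that fin b_def by simp
  have ab: "a < b" using amin[OF b(1,2)] b(3) by simp
  have first_atom: "first_atom x y = x \<union> {a, b}" by (simp add: first_atom_def a_def b_def)
  have ca: "{s \<in> y. s \<le> a} = insert a {s \<in> x. s \<le> a}"
    using a assms amin by (auto dest: order.antisym)
  have ea: "even (card {s \<in> y. s \<le> a} + a)" using assms a by (auto simp: alternating_def)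
  have none: "\<not> (a < t \<and> t < b)" if t: "t \<in> x" for t
  proof
    assume "a < t \<and> t < b"
    then have "{s \<in> y. s \<le> t} = insert a {s \<in> x. s \<le> t}"
      using assms a bmin by auto (meson le_less_trans not_le)
    then have "card {s \<in> y. s \<le> t} = Suc (card {s \<in> x. s \<le> t})" using fin a by simp
    moreover have "even (card {s \<in> y. s \<le> t} + t)" "even (card {s \<in> x. s \<le> t} + t)"
      using assms t by (auto simp: alternating_def)
    ultimately show False by simp
  qed
  have cb: "{s \<in> y. s \<le> b} = insert b (insert a {s \<in> x. s \<le> a})"
    using a b ab assms bmin none by auto (metis le_neq_implies_less not_le_imp_less order.antisym)+
  have eb: "even (card {s \<in> y. s \<le> b} + b)" using assms b by (auto simp: alternating_def)
  have "odd (card {s \<in> x. s \<le> a} + a)" "odd (a + b)"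
    using ea eb a b ab fin unfolding ca cb by (auto simp: card_insert_if)
  then show "alternating n (first_atom x y)" unfolding first_atom
    using assms a b ab none by (intro alternating_insert_pair) (auto simp: alternating_def)
  show "x \<subset> first_atom x y" "first_atom x y \<subseteq> y" using assms a b first_atom by auto
  have "first_atom x y - x = {a, b}" using first_atom a b by auto
  then show "card (first_atom x y - x) = 2" using ab by simp
  show "ascent x (first_atom x y) y"
    unfolding ascent_def first_atom using a b ab bmin by (auto simp: le_neq_implies_less dest: bmin)
qed

text \<open>An ascent puts the two elements of \<open>z - x\<close> below the rest of
  \<open>y - x\<close>. This lets \<open>toggle\<close> restore a member that it has
  deleted.\<close>

lemma first_atom_unique:
  assumes "alternating n x" "alternating n y" "x \<subset> z" "z \<subseteq> y" "card (z - x) = 2" "ascent x z y"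
  shows "first_atom x y = z"
proof -
  have fin: "finite x" "finite y" using assms alternating_finite by auto
  obtain p q where pq: "z - x = {p, q}" "p \<noteq> q" using assms(5) by (meson card_2_iff)
  obtain a b where ab: "z - x = {a, b}" "a < b"
    using pq by (metis insert_commute linorder_neqE_nat)
  have big: "b < t" if "t \<in> y" "t \<notin> z" for t using assms(6) that ab by (auto simp: ascent_def)
  have sub: "y - x = {a, b} \<union> (y - z)" using ab assms by auto
  have "Min (y - x) = a"
    by (rule Min_eqI) (use fin ab(2) big sub in \<open>auto intro: less_imp_le dest: less_trans[OF ab(2) big]\<close>)
  moreover have "Min (y - x - {a}) = b"
    by (rule Min_eqI) (use fin ab big sub in \<open>auto dest: less_imp_le less_trans\<close>)
  ultimately show ?thesis using ab assms by (auto simp: first_atom_def)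
qed

section \<open>The matching on chains and the inversion count\<close>

text \<open>The lower end is left free so that tails of chains are chains;
  \<open>alternating_chains\<close> will require it to be a singleton.\<close>

fun alternating_chain :: "nat \<Rightarrow> nat set list \<Rightarrow> bool" where
  "alternating_chain n [] \<longleftrightarrow> False"
| "alternating_chain n [x] \<longleftrightarrow> x = full n \<and> alternating n x"
| "alternating_chain n (x # y # zs) \<longleftrightarrow> alternating n x \<and> x \<subset> y \<and> alternating_chain n (y # zs)"

text \<open>The scan runs upwards from the lower end and stops at the first step that does not have
  size two, which is then refined by its first atom, or at the first ascent after a step of size
  two, whose middle is then deleted. \<open>inserts\<close> and \<open>deletes\<close> say which of
  the two happens; neither holds if all steps have size two and there is no ascent.\<close>

fun inserts :: "nat set list \<Rightarrow> bool" where
  "inserts (x # y # zs) \<longleftrightarrow>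
     card (y - x) \<noteq> 2 \<or> (zs \<noteq> [] \<and> \<not> ascent x y (hd zs) \<and> inserts (y # zs))"
| "inserts _ \<longleftrightarrow> False"

fun deletes :: "nat set list \<Rightarrow> bool" where
  "deletes (x # y # z # zs) \<longleftrightarrow> card (y - x) = 2 \<and> (ascent x y z \<or> deletes (y # z # zs))"
| "deletes _ \<longleftrightarrow> False"

fun toggle :: "nat set list \<Rightarrow> nat set list" where
  "toggle (x # y # zs) =
     (if card (y - x) \<noteq> 2 then x # first_atom x y # y # zs
      else if zs \<noteq> [] \<and> ascent x y (hd zs) then x # zs
      else x # toggle (y # zs))"
| "toggle xs = xs"

text \<open>Elements missing from \<open>y\<close> stand for those added in any later step; the missing elements outside
  \<open>full n\<close>, namely 0, contribute the same amount to all chains with given end points.\<close>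

definition inversions2 :: "nat set \<Rightarrow> nat set \<Rightarrow> nat" where
  "inversions2 x y = card {(s, t). s \<in> y - x \<and> t \<notin> y \<and> t < s}"

fun inversions :: "nat set list \<Rightarrow> nat" where
  "inversions (x # y # zs) = inversions2 x y + inversions (y # zs)"
| "inversions _ = 0"

text \<open>Merging two steps forgets exactly the inversions between them; every other pair
  survives, with \<open>t\<close> outside \<open>z\<close>.\<close>

lemma inversions2_merge:
  assumes "x \<subseteq> y" "y \<subseteq> z" "finite z"
  shows "inversions2 x y + inversions2 y z
    = inversions2 x z + card {(s, t). s \<in> y - x \<and> t \<in> z - y \<and> t < s}"
proof -
  let ?R = "\<lambda>A B. {(s::nat, t). s \<in> A \<and> t \<in> B \<and> t < s}"
  have fin: "finite (?R A B)" if "A \<subseteq> z" for A B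
  proof -
    have "?R A B \<subseteq> z \<times> {..Max z}" using that assms(3) 
      by (auto dest!: subsetD intro: order.trans[OF less_imp_le] )
    then show ?thesis using assms(3) finite_subset by blast
  qed
  have e: "inversions2 x y = card (?R (y - x) (- y))" "inversions2 y z = card (?R (z - y) (- z))"
    "inversions2 x z = card (?R (z - x) (- z))" by (simp_all add: inversions2_def)
  have 1: "?R (y - x) (- y) = ?R (y - x) (- z) \<union> ?R (y - x) (z - y)" using assms by auto
  have 2: "?R (z - x) (- z) = ?R (y - x) (- z) \<union> ?R (z - y) (- z)" using assms by auto
  have "card (?R (y - x) (- y)) = card (?R (y - x) (- z)) + card (?R (y - x) (z - y))"
    unfolding 1 by (rule card_Un_disjoint) (use assms fin[of "y - x"] fin[of "z - y"] in blast)+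
  moreover have "card (?R (z - x) (- z)) = card (?R (y - x) (- z)) + card (?R (z - y) (- z))"
    unfolding 2 by (rule card_Un_disjoint) (use assms fin[of "y - x"] fin[of "z - y"] in blast)+
  ultimately show ?thesis unfolding e by simp
qed

lemma inversions2_merge_ascent:
  assumes "x \<subseteq> y" "y \<subseteq> z" "finite z" "ascent x y z"
  shows "inversions2 x z = inversions2 x y + inversions2 y z"
proof -
  have "{(s, t). s \<in> y - x \<and> t \<in> z - y \<and> t < s} = {}" using assms(4) by (auto simp: ascent_def dest: less_asym)
  then show ?thesis using inversions2_merge[OF assms(1-3)] by (metis add_0_right card.empty)
qed

lemma inversions2_merge_not_ascent:
  assumes "x \<subseteq> y" "y \<subseteq> z" "finite z" "\<not> ascent x y z"
  shows "inversions2 x z < inversions2 x y + inversions2 y z"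
proof -
  let ?S = "{(s, t). s \<in> y - x \<and> t \<in> z - y \<and> t < s}"
  have "?S \<noteq> {}" using assms(4) by (auto simp: ascent_def not_less le_less)
  moreover have "finite ?S" by (rule finite_subset[of _ "z \<times> z"]) (use assms in auto)
  ultimately have "card ?S > 0" by (simp add: card_gt_0_iff)
  then show ?thesis using inversions2_merge[OF assms(1-3)] by linarith
qed

lemma alternating_chain_alternating: "alternating_chain n u \<Longrightarrow> x \<in> set u \<Longrightarrow> alternating n x"
  by (induction n u rule: alternating_chain.induct) auto

lemma alternating_chain_subset_last: "alternating_chain n u \<Longrightarrow> x \<in> set u \<Longrightarrow> x \<subseteq> full n"
  using alternating_chain_alternating unfolding alternating_def full_def by blast

lemma alternating_chain_hd_subset: "alternating_chain n (x # u) \<Longrightarrow> y \<in> set u \<Longrightarrow> x \<subset> y"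
proof (induction u arbitrary: x)
  case (Cons z u)
  then show ?case by (cases "y = z") (auto intro: psubset_trans)
qed simp

lemma alternating_chain_distinct: "alternating_chain n u \<Longrightarrow> distinct u"
proof (induction u)
  case (Cons x u)
  have "x \<notin> set u" using alternating_chain_hd_subset[OF Cons.prems] by blast
  moreover have "u \<noteq> [] \<Longrightarrow> alternating_chain n u" using Cons.prems by (cases u) auto
  ultimately show ?case using Cons.IH by (cases u) auto
qed simp

lemma alternating_chain_del_at:
  "alternating_chain n u \<Longrightarrow> 0 < i \<Longrightarrow> Suc i < length u \<Longrightarrow> alternating_chain n (del_at i u) \<and> hd (del_at i u) = hd u"
proof (induction n u arbitrary: i rule: alternating_chain.induct)
  case (3 n x y zs)
  then obtain j where i: "i = Suc j" by (cases i) auto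
  show ?case
  proof (cases j)
    case 0
    then obtain z ws where "zs = z # ws" using 3 i by (cases zs) auto
    then show ?thesis using 3 i 0 by (cases ws) (auto intro: psubset_trans)
  next
    case (Suc k)
    have "alternating_chain n (del_at j (y # zs)) \<and> hd (del_at j (y # zs)) = y"
      using "3.IH"[of j] "3.prems" i Suc by simp
    then show ?thesis using 3 i Suc by simp
  qed
qed auto

text \<open>After an insertion above \<open>y\<close> the scan of \<open>toggle\<close> must still
  pass \<open>y\<close>. The atom contributes the smallest elements of \<open>z - y\<close>, so
  comparing with these decides about all of them.\<close>

lemma ascent_first_atom_iff:
  assumes "alternating n y" "alternating n z" "y \<subset> z"
  shows "ascent x y (first_atom y z) \<longleftrightarrow> ascent x y z"
proof
  have a: "ascent y (first_atom y z) z" "y \<subset> first_atom y z" "first_atom y z \<subseteq> z" using first_atom_props[OF assms] by auto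
  show "ascent x y z \<Longrightarrow> ascent x y (first_atom y z)" using a by (auto simp: ascent_def)
  assume h: "ascent x y (first_atom y z)"
  show "ascent x y z"
    unfolding ascent_def
  proof (intro ballI)
    fix s t assume s: "s \<in> y - x" and t: "t \<in> z - y"
    show "s < t"
    proof (cases "t \<in> first_atom y z")
      case True
      then show ?thesis using h s t by (auto simp: ascent_def)
    next
      case False
      obtain r where "r \<in> first_atom y z - y" using a by blast
      then have "s < r" "r < t" using h a s t False by (auto simp: ascent_def)
      then show ?thesis by simp
    qed
  qed
qed

text \<open>The counterpart for deletions: \<open>z\<close> is the middle of an ascent and
  \<open>w\<close> becomes the new neighbour of \<open>y\<close>. Again the elements of
  \<open>z - y\<close> are the smallest ones to compare with.\<close>

lemma ascent_extend_iff:
  assumes "y \<subset> z" "ascent y z w"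
  shows "z \<subseteq> w \<Longrightarrow> ascent x y w \<longleftrightarrow> ascent x y z"
proof
  assume zw: "z \<subseteq> w"
  show "ascent x y w \<Longrightarrow> ascent x y z" using zw by (auto simp: ascent_def)
  assume h: "ascent x y z"
  show "ascent x y w"
    unfolding ascent_def
  proof (intro ballI)
    fix s t assume s: "s \<in> y - x" and t: "t \<in> w - y"
    show "s < t"
    proof (cases "t \<in> z")
      case True
      then show ?thesis using h s t by (auto simp: ascent_def)
    next
      case False
      obtain r where "r \<in> z - y" using assms by blast
      then have "s < r" "r < t" using h assms s t False by (auto simp: ascent_def)
      then show ?thesis by simp
    qed
  qed
qed

lemma hd_toggle: "hd (toggle u) = hd u"
  by (cases u rule: toggle.cases) auto

text \<open>The inversion count is unchanged because the new member is the middle of an ascent. The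
  clause on \<open>hd\<close> lets the induction pass below the place of insertion.\<close>

lemma toggle_inserts:
  assumes "alternating_chain n u" "inserts u"
  shows "alternating_chain n (toggle u) \<and> deletes (toggle u) \<and> toggle (toggle u) = u \<and>
    length (toggle u) = Suc (length u) \<and> hd (toggle u) = hd u \<and>
    inversions (toggle u) = inversions u \<and>
    (\<exists>i\<in>{1..<length u}. del_at i (toggle u) = u)"
  using assms
proof (induction u rule: toggle.induct)
  case (1 x y zs)
  have alternating: "alternating n x" "alternating n y" "x \<subset> y" using 1(2) alternating_chain_alternating[OF 1(2)] by auto
  note fin = alternating_finite[OF alternating(2)]
  show ?case
  proof (cases "card (y - x) = 2")
    case False
    note first_atom = first_atom_props[OF alternating]
    have ne: "first_atom x y \<noteq> y" using first_atom(4) False by metis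
    have "inversions2 x y = inversions2 x (first_atom x y) + inversions2 (first_atom x y) y"
      by (rule inversions2_merge_ascent) (use first_atom fin in auto)
    moreover have "del_at 1 (x # first_atom x y # y # zs) = x # y # zs" by simp
    then have "\<exists>i\<in>{1..<length (x # y # zs)}. del_at i (x # first_atom x y # y # zs) = x # y # zs"
      by (intro bexI[of _ 1]) auto
    ultimately show ?thesis using False first_atom ne alternating 1(2) by auto
  next
    case True
    then obtain z ws where zs: "zs = z # ws" and na: "\<not> ascent x y z" and U: "inserts (y # zs)"
      using 1(3) by (cases zs) auto
    have IH: "alternating_chain n (toggle (y # zs))" "deletes (toggle (y # zs))" "toggle (toggle (y # zs)) = y # zs"
      "length (toggle (y # zs)) = Suc (length (y # zs))" "hd (toggle (y # zs)) = y"
      "inversions (toggle (y # zs)) = inversions (y # zs)"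
      "\<exists>i\<in>{1..<length (y # zs)}. del_at i (toggle (y # zs)) = y # zs"
      using 1(1) 1(2) True U zs na by auto
    obtain w vs where tg: "toggle (y # zs) = y # w # vs"
      using IH(4,5) by (cases "toggle (y # zs)"; cases "tl (toggle (y # zs))") auto
    have altz: "alternating n z" "y \<subset> z" using 1(2) zs alternating_chain_alternating[OF 1(2)] by auto
    \<comment> \<open>The branch that deletes \<open>z\<close> would shorten the list, contrary to
      \<open>IH(4)\<close>.\<close>
    have "w = z \<or> w = first_atom y z"
      using tg zs IH(4) hd_toggle[of "z # ws"] by (auto split: if_splits)
    then have na': "\<not> ascent x y w" using na ascent_first_atom_iff[OF alternating(2) altz] by auto
    have T: "toggle (x # y # zs) = x # y # w # vs" using True zs na tg by simp
    obtain i where i: "i \<in> {1..<length (y # zs)}" "del_at i (toggle (y # zs)) = y # zs" using IH(7) by blast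
    then have "\<exists>i\<in>{1..<length (x # y # zs)}. del_at i (x # y # w # vs) = x # y # zs"
      using tg by (intro bexI[of _ "Suc i"]) auto
    then show ?thesis unfolding T using IH tg alternating True na' zs by simp
  qed
qed auto

lemma toggle_deletes:
  assumes "alternating_chain n v" "deletes v"
  shows "alternating_chain n (toggle v) \<and> inserts (toggle v) \<and> toggle (toggle v) = v \<and>
    Suc (length (toggle v)) = length v \<and> hd (toggle v) = hd v"
  using assms
proof (induction v rule: toggle.induct)
  case (1 x y zs)
  then obtain z ws where zs: "zs = z # ws" by (cases zs) auto
  have alternating: "alternating n x" "alternating n y" "alternating n z" "x \<subset> y" "y \<subset> z" using 1(2) alternating_chain_alternating[OF 1(2)] zs by auto
  have c2: "card (y - x) = 2" using 1(3) zs by simp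
  show ?case
  proof (cases "ascent x y z")
    case True
    have "first_atom x z = y" by (rule first_atom_unique) (use alternating c2 True in auto)
    moreover have "card (z - x) \<noteq> 2"
    proof -
      have "card (y - x) < card (z - x)"
        by (rule psubset_card_mono) (use alternating alternating_finite[of n z] in auto)
      then show ?thesis using c2 by simp
    qed
    ultimately show ?thesis using c2 True zs 1(2) by auto
  next
    case False
    then have V: "deletes (y # zs)" using 1(3) zs by simp
    have IH: "alternating_chain n (toggle (y # zs))" "inserts (toggle (y # zs))" "toggle (toggle (y # zs)) = y # zs"
      "Suc (length (toggle (y # zs))) = length (y # zs)" "hd (toggle (y # zs)) = y"
      using 1(1) 1(2) c2 V zs False by auto
    obtain w vs where tg: "toggle (y # zs) = y # w # vs"
      using IH(2,5) by (cases "toggle (y # zs)"; cases "tl (toggle (y # zs))") auto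
    have na: "\<not> ascent x y w"
    \<comment> \<open>In the first case \<open>toggle\<close> deletes \<open>z\<close> from the
      tail, so that \<open>y\<close> gets the successor of \<open>z\<close> as its neighbour;
      otherwise \<open>z\<close> stays.\<close>
    proof (cases "ws \<noteq> [] \<and> ascent y z (hd ws) \<and> card (z - y) = 2")
      case True
      then obtain w' ws' where ws: "ws = w' # ws'" by (cases ws) auto
      then have "w = w'" using tg zs True by auto
      moreover have "z \<subseteq> w'" using 1(2) zs ws by (cases ws') auto
      ultimately show ?thesis using ascent_extend_iff[OF alternating(5)] True ws False by auto
    next
      case F: False
      have "card (z - y) = 2" using V zs by (cases ws) auto
      then have "w = z" using F tg zs hd_toggle[of "z # ws"] by (auto split: if_splits)
      then show ?thesis using False by simp
    qed
    have T: "toggle (x # y # zs) = x # y # w # vs" using c2 zs False tg by simp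
    show ?thesis unfolding T using IH tg alternating c2 na zs False by simp
  qed
qed auto

text \<open>Acyclicity of the matching. Deleting the middle of a non-ascent lowers
  \<open>inversions\<close>, and deleting the middle of the first ascent is \<open>toggle\<close>. A
  deletion above the first ascent either leaves that ascent in place, so that the face does not
  satisfy \<open>inserts\<close>, or removes its upper end, and then a non-ascent has been
  deleted.\<close>

lemma del_at_inserts_cases:
  assumes "alternating_chain n v" "deletes v" "0 < i" "Suc i < length v" "inserts (del_at i v)"
  shows "del_at i v = toggle v \<or> inversions (del_at i v) < inversions v"
  using assms
proof (induction v arbitrary: i rule: toggle.induct)
  case (1 x y zs)
  then obtain z ws where zs: "zs = z # ws" by (cases zs) auto
  have alternating: "alternating n x" "alternating n y" "alternating n z" "x \<subset> y" "y \<subset> z" using 1(2) alternating_chain_alternating[OF 1(2)] zs by auto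
  have c2: "card (y - x) = 2" using 1(3) zs by simp
  obtain j where i: "i = Suc j" using 1(4) by (cases i) auto
  show ?case
  proof (cases j)
    case 0
    have D: "del_at i (x # y # zs) = x # z # ws" using i 0 zs by simp
    show ?thesis
    proof (cases "ascent x y z")
      case True
      then show ?thesis using D c2 zs by simp
    next
      case False
      have "inversions2 x z < inversions2 x y + inversions2 y z"
        by (rule inversions2_merge_not_ascent) (use alternating alternating_finite[of n z] False in auto)
      then show ?thesis unfolding D by (cases ws) (auto simp: zs)
    qed
  next
    case (Suc k)
    show ?thesis
    proof (cases "ascent x y z")
      case True
      \<comment> \<open>A deletion further up would keep \<open>x\<close>, \<open>y\<close>,
        \<open>z\<close> and their ascent.\<close>
      have "k = 0"
      proof (rule ccontr)
        assume "k \<noteq> 0"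
        then obtain k' where "k = Suc k'" by (cases k) auto
        then show False using 1(6) True c2 zs i Suc by simp
      qed
      then have D: "del_at i (x # y # zs) = x # y # ws" using i Suc zs by simp
      obtain w ws' where ws: "ws = w # ws'" using 1(5) i Suc zs by (cases ws) auto
      have w: "z \<subset> w" "alternating n w" using 1(2) alternating_chain_alternating[OF 1(2)] zs ws by auto
      have "\<not> ascent x y w" using 1(6) D c2 ws by simp
      \<comment> \<open>Otherwise the ascent at \<open>y\<close> would extend from \<open>z\<close>
        to \<open>w\<close>.\<close>
      then have "\<not> ascent y z w" using ascent_extend_iff[OF alternating(5), of w x] w True by auto
      then have "inversions2 y w < inversions2 y z + inversions2 z w"
        by (intro inversions2_merge_not_ascent) (use alternating w alternating_finite[of n w] in auto)
      then show ?thesis unfolding D by (cases ws') (auto simp: zs ws)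
    next
      case False
      have D: "del_at i (x # y # zs) = x # del_at j (y # zs)" using i by simp
      have dj: "del_at j (y # zs) = y # del_at k zs" using Suc by simp
      have "inserts (y # del_at k zs)" using 1(6) c2 unfolding D dj by simp
      then have "del_at j (y # zs) = toggle (y # zs)
          \<or> inversions (del_at j (y # zs)) < inversions (y # zs)"
        using 1(1)[of j] 1(2-5) c2 False zs i Suc by simp
      then show ?thesis unfolding D dj using c2 False zs by auto
    qed
  qed
qed auto

text \<open>Every step adds at least two of the \<open>2 * n - 1\<close> elements of
  \<open>full n\<close>. If \<open>inserts\<close> holds some step adds more; if neither condition
  holds each adds exactly two. This places all critical chains in one degree and shows that this
  degree is the highest.\<close>

lemma alternating_chain_card_le:
  assumes "alternating_chain n u" shows "card (hd u) + 2 * (length u - 1) \<le> 2 * n - 1"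
  and "inserts u \<Longrightarrow> card (hd u) + 2 * (length u - 1) < 2 * n - 1"
  and "\<not> inserts u \<Longrightarrow> \<not> deletes u \<Longrightarrow> card (hd u) + 2 * (length u - 1) = 2 * n - 1"
  using assms
proof (induction n u rule: alternating_chain.induct)
  case (2 n x)
  { case 1 then show ?case by (simp add: full_def) }
  { case 2 then show ?case by simp }
  { case 3 then show ?case by (simp add: full_def) }
next
  case (3 n x y zs)
  have *: "card (hd (x # y # zs)) + 2 * (length (x # y # zs) - 1) + (card (y - x) - 2)
      = card (hd (y # zs)) + 2 * (length (y # zs) - 1)" "card (y - x) \<ge> 2"
    if "alternating_chain n (x # y # zs)"
  proof -
    have alternating: "alternating n x" "alternating n y" "x \<subset> y" using that alternating_chain_alternating[OF that] by auto
    then have "card (y - x) + card x = card y"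
      using alternating_finite[of n x] alternating_finite[of n y] card_mono[of y x]
      by (subst card_Diff_subset) auto
    moreover show "card (y - x) \<ge> 2" using even_card_diff[OF alternating] by simp
    ultimately show "card (hd (x # y # zs)) + 2 * (length (x # y # zs) - 1) + (card (y - x) - 2)
      = card (hd (y # zs)) + 2 * (length (y # zs) - 1)" by simp
  qed
  { case 1
    then have "alternating_chain n (y # zs)" by simp
    then show ?case using 3(1) *[OF 1] by linarith }
  { case 2
    then have "alternating_chain n (y # zs)" by simp
    then show ?case using 3(1,2) *[OF 2(2)] 2(1) by auto }
  { case 3
    then have t: "alternating_chain n (y # zs)" and c: "card (y - x) = 2" by simp_all
    have "\<not> inserts (y # zs)" "\<not> deletes (y # zs)" using 3(1,2) c by (cases zs; auto)+
    then show ?case using "3.IH"(3) t c *[OF 3(3)] by simp }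
qed simp_all

section \<open>Homology of the chains of alternating sets\<close>

definition alternating_chains :: "nat \<Rightarrow> nat \<Rightarrow> nat set list set" where
  "alternating_chains n l = {u. length u = Suc l \<and> alternating_chain n u \<and> card (hd u) = 1}"

definition critical_chains :: "nat \<Rightarrow> nat set list set" where
  "critical_chains n = {u \<in> alternating_chains n (n - 1). \<not> inserts u \<and> \<not> deletes u}"

lemma supp_on_add:
  "supp_on X a \<Longrightarrow> supp_on X b \<Longrightarrow> supp_on X (\<lambda>x. a x + b x :: 'k::comm_ring_1)"
  unfolding supp_on_def by (metis add.right_neutral)

lemma supp_on_diff:
  "supp_on X a \<Longrightarrow> supp_on X b \<Longrightarrow> supp_on X (\<lambda>x. a x - b x :: 'k::comm_ring_1)"
  unfolding supp_on_def by (metis diff_zero)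

lemma supp_on_0: "supp_on X a \<Longrightarrow> x \<notin> X \<Longrightarrow> a x = 0"
  unfolding supp_on_def by blast

lemma finite_alternating_chains: "finite (alternating_chains n l)"
proof (rule finite_subset)
  show "alternating_chains n l \<subseteq> {u. set u \<subseteq> Pow (full n) \<and> length u = Suc l}"
    using alternating_chain_subset_last by (auto simp: alternating_chains_def)
  show "finite {u. set u \<subseteq> Pow (full n) \<and> length u = Suc l}"
    by (rule finite_lists_length_eq) (simp add: full_def)
qed

lemma alternating_chains_del_at: "u \<in> alternating_chains n l \<Longrightarrow> i \<in> {1..<l} \<Longrightarrow> del_at i u \<in> alternating_chains n (l - 1)"
  using alternating_chain_del_at[of n u i] by (auto simp: alternating_chains_def length_del_at)

lemma alternating_chains_card_le: "u \<in> alternating_chains n l \<Longrightarrow> 2 * l + 1 \<le> 2 * n - 1"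
  using alternating_chain_card_le(1)[of n u] by (simp add: alternating_chains_def)

lemma alternating_chains_empty: "n \<ge> 1 \<Longrightarrow> l > n - 1 \<Longrightarrow> alternating_chains n l = {}"
  using alternating_chains_card_le[of _ n l] by fastforce

lemma alternating_chains_top_not_inserts: "u \<in> alternating_chains n (n - 1) \<Longrightarrow> \<not> inserts u"
  using alternating_chain_card_le(2)[of n u] by (auto simp: alternating_chains_def)

lemma alternating_chains_critical: "n \<ge> 1 \<Longrightarrow> u \<in> alternating_chains n l \<Longrightarrow> \<not> inserts u \<Longrightarrow> \<not> deletes u \<Longrightarrow> l = n - 1 \<and> u \<in> critical_chains n"
  using alternating_chain_card_le(3)[of n u] by (auto simp: alternating_chains_def critical_chains_def)

lemma boundary_alternating_chains_supp: "supp_on (alternating_chains n (l - 1)) (boundary (alternating_chains n l) c)"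
proof -
  have "w \<in> alternating_chains n (l - 1)" if nz: "boundary (alternating_chains n l) c w \<noteq> 0" for w
  proof -
    obtain v where v: "v \<in> alternating_chains n l" "incidence v w * c v \<noteq> 0"
      using nz unfolding boundary_def by (rule sum.not_neutral_contains_not_neutral)
    then have "(incidence v w :: 'a) \<noteq> 0" by auto
    then obtain i where "i \<in> {1..<length v - 1}" "del_at i v = w" by (rule incidence_nonzeroE)
    then show ?thesis using v(1) alternating_chains_del_at[of v n l i] by (auto simp: alternating_chains_def)
  qed
  then show ?thesis by (simp add: supp_on_def)
qed

lemma boundary_boundary_alternating_chains: "boundary (alternating_chains n l) (boundary (alternating_chains n (Suc l)) c) u = 0"
  by (rule boundary_boundary[where l = "Suc l"]) (use finite_alternating_chains alternating_chains_del_at[of _ n "Suc l"] in \<open>auto simp: alternating_chains_def\<close>)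

section \<open>The boundary as a triangular matrix\<close>

lemma toggle_inserts_in: "u \<in> alternating_chains n l \<Longrightarrow> inserts u \<Longrightarrow> toggle u \<in> alternating_chains n (Suc l)"
  using toggle_inserts[of n u] by (simp add: alternating_chains_def)

lemma toggle_deletes_in: "v \<in> alternating_chains n (Suc l) \<Longrightarrow> deletes v \<Longrightarrow> toggle v \<in> alternating_chains n l"
  using toggle_deletes[of n v] unfolding alternating_chains_def by auto

lemma toggle_bij:
  "bij_betw toggle {u \<in> alternating_chains n l. inserts u} {v \<in> alternating_chains n (Suc l). deletes v}"
proof (rule bij_betw_byWitness[where f' = toggle])
  show "\<forall>u\<in>{u \<in> alternating_chains n l. inserts u}. toggle (toggle u) = u"
    using toggle_inserts by (auto simp: alternating_chains_def)
  show "\<forall>v\<in>{v \<in> alternating_chains n (Suc l). deletes v}. toggle (toggle v) = v"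
    using toggle_deletes by (auto simp: alternating_chains_def)
  show "toggle ` {u \<in> alternating_chains n l. inserts u} \<subseteq> {v \<in> alternating_chains n (Suc l). deletes v}"
  proof (intro image_subsetI CollectI conjI)
    fix u assume "u \<in> {u \<in> alternating_chains n l. inserts u}"
    then show "toggle u \<in> alternating_chains n (Suc l)" "deletes (toggle u)"
      using toggle_inserts_in[of u n l] toggle_inserts[of n u] by (auto simp: alternating_chains_def)
  qed
  show "toggle ` {v \<in> alternating_chains n (Suc l). deletes v} \<subseteq> {u \<in> alternating_chains n l. inserts u}"
  proof (intro image_subsetI CollectI conjI)
    fix v assume "v \<in> {v \<in> alternating_chains n (Suc l). deletes v}"
    then show "toggle v \<in> alternating_chains n l" "inserts (toggle v)"
      using toggle_deletes_in[of v n l] toggle_deletes[of n v] by (auto simp: alternating_chains_def)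
  qed
qed

text \<open>Indexing the chains with \<open>deletes\<close> by their partners makes the matrix
  square; the triangular lemmas then apply with \<open>inversions\<close> as potential.\<close>

lemma boundary_on_deletes:
  fixes y :: "nat set list \<Rightarrow> 'k::comm_ring_1"
  assumes "supp_on {v \<in> alternating_chains n (Suc l). deletes v} y"
  shows "boundary (alternating_chains n (Suc l)) y u' = (\<Sum>u\<in>{u \<in> alternating_chains n l. inserts u}. incidence (toggle u) u' * y (toggle u))"
proof -
  have "boundary (alternating_chains n (Suc l)) y u' = (\<Sum>v\<in>{v \<in> alternating_chains n (Suc l). deletes v}. incidence v u' * y v)"
    unfolding boundary_def
  proof (rule sum.mono_neutral_right[OF finite_alternating_chains])
    show "\<forall>v\<in>alternating_chains n (Suc l) - {v \<in> alternating_chains n (Suc l). deletes v}. incidence v u' * y v = 0"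
    proof
      fix v assume "v \<in> alternating_chains n (Suc l) - {v \<in> alternating_chains n (Suc l). deletes v}"
      then have "y v = 0" using assms unfolding supp_on_def by blast
      then show "incidence v u' * y v = 0" by simp
    qed
  qed auto
  also have "\<dots> = (\<Sum>u\<in>{u \<in> alternating_chains n l. inserts u}. incidence (toggle u) u' * y (toggle u))"
    using sum.reindex_bij_betw[OF toggle_bij[of n l], of "\<lambda>v. incidence v u' * y v"] by simp
  finally show ?thesis .
qed

lemma incidence_toggle_self:
  assumes "u \<in> alternating_chains n l" "inserts u"
  shows "incidence (toggle u) u * incidence (toggle u) u = (1 :: 'k::comm_ring_1)"
proof -
  have t: "alternating_chain n (toggle u)" "length (toggle u) = Suc (length u)"
    "\<exists>i\<in>{1..<length u}. del_at i (toggle u) = u" using toggle_inserts[of n u] assms by (auto simp: alternating_chains_def)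
  then obtain i where i: "i \<in> {1..<length (toggle u) - 1}" "del_at i (toggle u) = u" by auto
  have "incidence (toggle u) (del_at i (toggle u)) = ((-1) ^ i :: 'k)"
    by (rule incidence_del_at[OF alternating_chain_distinct[OF t(1)] i(1)])
  then show ?thesis unfolding i(2) by (simp add: power_add[symmetric])
qed

text \<open>The potential is that of \<open>u\<close>, not of \<open>toggle u\<close>: the two
  agree, so a strict drop below \<open>toggle u\<close> is one below \<open>u\<close>.\<close>

lemma incidence_toggle_other:
  assumes "u \<in> alternating_chains n l" "inserts u" "inserts u'" "u \<noteq> u'" "incidence (toggle u) u' \<noteq> (0 :: 'k::comm_ring_1)"
  shows "inversions u' < inversions u"
proof -
  have t: "alternating_chain n (toggle u)" "deletes (toggle u)" "toggle (toggle u) = u"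
    "inversions (toggle u) = inversions u" using toggle_inserts[of n u] assms by (auto simp: alternating_chains_def)
  obtain i where i: "i \<in> {1..<length (toggle u) - 1}" "del_at i (toggle u) = u'"
    using assms(5) by (rule incidence_nonzeroE)
  then show ?thesis using del_at_inserts_cases[OF t(1,2), of i] t assms(3,4) by auto
qed

lemma boundary_on_deletes_solvable:
  fixes g :: "nat set list \<Rightarrow> 'k::comm_ring_1"
  shows "\<exists>y. supp_on {v \<in> alternating_chains n (Suc l). deletes v} y \<and>
    (\<forall>u\<in>alternating_chains n l. inserts u \<longrightarrow> boundary (alternating_chains n (Suc l)) y u = g u)"
proof -
  let ?U = "{u \<in> alternating_chains n l. inserts u}"
  have "\<exists>y. \<forall>u'\<in>?U. (\<Sum>u\<in>?U. incidence (toggle u) u' * y u) = g u'"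
    by (rule triangular_solvable[where pot = inversions])
      (use incidence_toggle_self incidence_toggle_other finite_alternating_chains in \<open>fastforce+\<close>)
  then obtain y where y: "\<forall>u'\<in>?U. (\<Sum>u\<in>?U. incidence (toggle u) u' * y u) = g u'" by blast
  let ?y = "\<lambda>v. if v \<in> alternating_chains n (Suc l) \<and> deletes v then y (toggle v) else 0"
  have s: "supp_on {v \<in> alternating_chains n (Suc l). deletes v} ?y" by (simp add: supp_on_def)
  have *: "?y (toggle u) = y u" if "u \<in> ?U" for u
    using that toggle_inserts[of n u] by (simp add: alternating_chains_def)
  have "boundary (alternating_chains n (Suc l)) ?y u' = (\<Sum>u\<in>?U. incidence (toggle u) u' * y u)" for u'
    unfolding boundary_on_deletes[OF s] using * by (intro sum.cong) simp_all
  then show ?thesis using s y by (intro exI[of _ ?y]) simp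
qed

lemma boundary_on_deletes_injective:
  fixes y :: "nat set list \<Rightarrow> 'k::comm_ring_1"
  assumes "supp_on {v \<in> alternating_chains n (Suc l). deletes v} y"
    and "\<And>u. u \<in> alternating_chains n l \<Longrightarrow> inserts u \<Longrightarrow> boundary (alternating_chains n (Suc l)) y u = 0"
  shows "y v = 0"
proof (rule ccontr)
  assume "y v \<noteq> 0"
  then have v: "v \<in> alternating_chains n (Suc l)" "deletes v" using assms(1) by (auto simp: supp_on_def)
  then have tv: "toggle v \<in> {u \<in> alternating_chains n l. inserts u}" "toggle (toggle v) = v"
    using toggle_deletes[of n v] by (auto simp: alternating_chains_def)
  have "y (toggle (toggle v)) = 0"
    by (rule triangular_unique[where pot = inversions and U = "{u \<in> alternating_chains n l. inserts u}"
          and M = "\<lambda>u' u. incidence (toggle u) u'" and y = "\<lambda>u. y (toggle u)"])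
      (use incidence_toggle_self incidence_toggle_other finite_alternating_chains tv(1) assms boundary_on_deletes[OF assms(1)] in \<open>fastforce+\<close>)
  then show False using tv \<open>y v \<noteq> 0\<close> by simp
qed

section \<open>Exactness outside the top degree and cycles in the top degree\<close>

text \<open>Such a cycle lives on the chains with \<open>deletes\<close>, where the boundary is
  injective, being determined by its values on their partners.\<close>

lemma cycle_eq_0:
  fixes w :: "nat set list \<Rightarrow> 'k::comm_ring_1"
  assumes "n \<ge> 1" "supp_on (alternating_chains n l) w" "\<And>u. inserts u \<Longrightarrow> w u = 0" "\<And>u. u \<in> critical_chains n \<Longrightarrow> w u = 0"
    and "\<And>u. boundary (alternating_chains n l) w u = 0"
  shows "w u = 0"
proof -
  have s: "supp_on {v \<in> alternating_chains n l. deletes v} w"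
    using assms alternating_chains_critical[OF assms(1), of _ l] unfolding supp_on_def by blast
  show ?thesis
  proof (cases l)
    case 0
    have "\<not> deletes v" if "v \<in> alternating_chains n 0" for v using that by (cases v; cases "tl v") (auto simp: alternating_chains_def)
    then show ?thesis using s 0 unfolding supp_on_def by blast
  next
    case (Suc l')
    then show ?thesis using boundary_on_deletes_injective[of n l' w u] s assms(5) by simp
  qed
qed

text \<open>Solve for the boundary on the chains with \<open>inserts\<close> only. The error is a
  cycle that vanishes there, and there are no critical chains in this degree, so it is zero
  everywhere.\<close>

lemma alternating_chains_exact:
  fixes c :: "nat set list \<Rightarrow> 'k::comm_ring_1"
  assumes "n \<ge> 1" "l \<noteq> n - 1" "supp_on (alternating_chains n l) c" "\<And>u. boundary (alternating_chains n l) c u = 0"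
  shows "\<exists>y. supp_on (alternating_chains n (Suc l)) y \<and> boundary (alternating_chains n (Suc l)) y = c"
proof -
  obtain y where y: "supp_on {v \<in> alternating_chains n (Suc l). deletes v} y"
    "\<forall>u\<in>alternating_chains n l. inserts u \<longrightarrow> boundary (alternating_chains n (Suc l)) y u = c u"
    using boundary_on_deletes_solvable[of n l c] by blast
  let ?w = "\<lambda>u. boundary (alternating_chains n (Suc l)) y u - c u"
  have sb: "supp_on (alternating_chains n l) (boundary (alternating_chains n (Suc l)) y)" using boundary_alternating_chains_supp[of n "Suc l" y] by simp
  have "?w u = 0" for u
  proof (rule cycle_eq_0[OF assms(1), of l ?w])
    show s: "supp_on (alternating_chains n l) ?w" using sb assms(3) by (rule supp_on_diff)
    fix u
    show "?w u = 0" if "inserts u" using that s y(2) unfolding supp_on_def by fastforce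
    show "?w u = 0" if "u \<in> critical_chains n"
    proof -
      have "u \<notin> alternating_chains n l" using that assms(2) by (auto simp: critical_chains_def alternating_chains_def)
      then show ?thesis using s unfolding supp_on_def by blast
    qed
    show "boundary (alternating_chains n l) ?w u = 0" by (simp add: boundary_diff boundary_boundary_alternating_chains assms(4))
  qed
  then have "boundary (alternating_chains n (Suc l)) y = c" by (simp add: fun_eq_iff)
  moreover have "supp_on (alternating_chains n (Suc l)) y" using y(1) by (auto simp: supp_on_def)
  ultimately show ?thesis by blast
qed

lemma alternating_chains_top_cycle_unique:
  fixes z :: "nat set list \<Rightarrow> 'k::comm_ring_1"
  assumes "n \<ge> 1" "supp_on (alternating_chains n (n - 1)) z" "\<And>u. boundary (alternating_chains n (n - 1)) z u = 0"
    and "\<And>u. u \<in> critical_chains n \<Longrightarrow> z u = 0"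
  shows "z u = 0"
proof (rule cycle_eq_0[OF assms(1,2) _ assms(4,3)])
  fix u :: "nat set list" assume "inserts u"
  then show "z u = 0" using alternating_chains_top_not_inserts assms(2) unfolding supp_on_def by blast
qed auto

text \<open>Extend \<open>g\<close> by zero and correct it on the chains with
  \<open>deletes\<close>, which leaves the critical values alone, until the boundary vanishes on the
  chains with \<open>inserts\<close>. The boundary is itself a cycle one degree lower, so it then
  vanishes altogether.\<close>

lemma alternating_chains_top_cycle_exists:
  fixes g :: "nat set list \<Rightarrow> 'k::comm_ring_1"
  assumes "n \<ge> 1"
  shows "\<exists>z. supp_on (alternating_chains n (n - 1)) z \<and> (\<forall>u. boundary (alternating_chains n (n - 1)) z u = 0) \<and> (\<forall>u\<in>critical_chains n. z u = g u)"
proof -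
  let ?g = "\<lambda>u. if u \<in> critical_chains n then g u else 0"
  have gs: "supp_on (alternating_chains n (n - 1)) ?g" by (simp add: supp_on_def critical_chains_def)
  show ?thesis
  proof (cases "n - 1")
    case 0
    have "boundary (alternating_chains n 0) ?g u = 0" for u
      unfolding boundary_def by (rule sum.neutral) (auto simp: incidence_def alternating_chains_def)
    then show ?thesis using gs 0 by (intro exI[of _ ?g]) simp
  next
    case (Suc l)
    obtain v where v: "supp_on {v \<in> alternating_chains n (Suc l). deletes v} v"
      "\<forall>u\<in>alternating_chains n l. inserts u \<longrightarrow> boundary (alternating_chains n (Suc l)) v u = - boundary (alternating_chains n (Suc l)) ?g u"
      using boundary_on_deletes_solvable[of n l "\<lambda>u. - boundary (alternating_chains n (Suc l)) ?g u"] by blast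
    let ?z = "\<lambda>u. v u + ?g u"
    have sz: "supp_on (alternating_chains n (Suc l)) ?z" 
    proof (rule supp_on_add)
      show "supp_on (alternating_chains n (Suc l)) v" using v(1) by (auto simp: supp_on_def)
      show "supp_on (alternating_chains n (Suc l)) ?g" using gs Suc by simp
    qed
    have "boundary (alternating_chains n (Suc l)) ?z u = 0" for u
    proof (rule cycle_eq_0[OF assms, of l])
      show s: "supp_on (alternating_chains n l) (boundary (alternating_chains n (Suc l)) ?z)" using boundary_alternating_chains_supp[of n "Suc l" ?z] by simp
      fix u
      show "boundary (alternating_chains n (Suc l)) ?z u = 0" if "inserts u"
      proof (cases "u \<in> alternating_chains n l")
        case True
        then show ?thesis using v(2) that by (simp add: boundary_add)
      next
        case False
        then show ?thesis using s unfolding supp_on_def by blast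
      qed
      show "boundary (alternating_chains n (Suc l)) ?z u = 0" if "u \<in> critical_chains n"
      proof -
        have "u \<notin> alternating_chains n l" using that Suc by (auto simp: critical_chains_def alternating_chains_def)
        then show ?thesis using s unfolding supp_on_def by blast
      qed
      show "boundary (alternating_chains n l) (boundary (alternating_chains n (Suc l)) ?z) u = 0" by (rule boundary_boundary_alternating_chains)
    qed
    moreover have "?z u = g u" if "u \<in> critical_chains n" for u
    proof -
      have "\<not> deletes u" using that by (simp add: critical_chains_def)
      then show ?thesis using v(1) that unfolding supp_on_def by fastforce
    qed
    ultimately show ?thesis using sz Suc by (intro exI[of _ ?z]) simp
  qed
qed

section \<open>Critical chains and binary trees\<close>

fun critical_chain :: "nat \<Rightarrow> nat set list \<Rightarrow> bool" where
  "critical_chain n [] \<longleftrightarrow> False"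
| "critical_chain n [x] \<longleftrightarrow> x = full n \<and> alternating n x"
| "critical_chain n (x # y # zs) \<longleftrightarrow> alternating n x \<and> x \<subset> y \<and> card (y - x) = 2 \<and>
     (zs = [] \<or> \<not> ascent x y (hd zs)) \<and> critical_chain n (y # zs)"

lemma critical_chain_iff: "critical_chain n u \<longleftrightarrow> alternating_chain n u \<and> \<not> inserts u \<and> \<not> deletes u"
proof (induction n u rule: critical_chain.induct)
  case (3 n x y zs)
  then show ?case by (cases zs) auto
qed auto

text \<open>Induction from the upper end. If the next step adds \<open>a' < b'\<close>, then the
  missing ascent gives \<open>a' < b\<close>, and since \<open>b\<close> cannot lie between
  \<open>a'\<close> and \<open>b'\<close>, also \<open>b' < b\<close>. Everything above
  \<open>b\<close> is thus present already.\<close>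

lemma critical_chain_step:
  assumes "critical_chain n (x # y # zs)"
  shows "\<exists>a b. a < b \<and> y = x \<union> {a, b} \<and> a \<notin> x \<and> b \<notin> x \<and> b < 2 * n \<and> 1 \<le> a \<and> {b<..<2 * n} \<subseteq> x"
  using assms
proof (induction zs arbitrary: x y)
  case Nil
  then have y: "y = full n" "x \<subset> y" "card (y - x) = 2" by auto
  then obtain p q where "y - x = {p, q}" "p \<noteq> q" by (meson card_2_iff)
  then obtain a b where ab: "y - x = {a, b}" "a < b" by (metis insert_commute linorder_neqE_nat)
  have m: "a \<in> full n" "b \<in> full n" "a \<notin> x" "b \<notin> x" using ab y(1) by auto
  have "{b<..<2 * n} \<subseteq> x"
  proof
    fix t assume t: "t \<in> {b<..<2 * n}"
    then have "t \<in> y" "t \<notin> {a, b}" using y(1) ab(2) by (auto simp: full_def)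
    then show "t \<in> x" using ab(1) by blast
  qed
  moreover have "y = x \<union> {a, b}" using ab y(2) by blast
  ultimately show ?case using ab(2) m by (intro exI[of _ a] exI[of _ b]) (auto simp: full_def)
next
  case (Cons z zs)
  have c: "alternating n x" "x \<subset> y" "card (y - x) = 2" "\<not> ascent x y z" "critical_chain n (y # z # zs)"
    using Cons.prems by auto
  have alty: "alternating n y" "alternating n z" using c(5) by (cases zs; auto)+
  obtain a' b' where ab': "a' < b'" "z = y \<union> {a', b'}" "a' \<notin> y" "b' \<notin> y" "b' < 2 * n"
    "{b'<..<2 * n} \<subseteq> y" using Cons.IH[OF c(5)] by blast
  obtain p q where "y - x = {p, q}" "p \<noteq> q" using c(3) by (meson card_2_iff)
  then obtain a b where ab: "y - x = {a, b}" "a < b" by (metis insert_commute linorder_neqE_nat)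
  have m: "a \<in> y" "b \<in> y" "a \<notin> x" "b \<notin> x" using ab by auto
  have "z - y = {a', b'}" using ab' by auto
  then have "\<exists>s\<in>{a, b}. \<exists>t\<in>{a', b'}. \<not> s < t" using c(4) ab(1) unfolding ascent_def by simp
  then have "a' \<le> b" using ab(2) ab'(1) by force
  then have "a' < b" using m ab'(3) by (metis le_neq_implies_less)
  then have "b' < b"
    using alternating_insert_pairD[of n y a' b' b] alty ab' m by (metis linorder_neqE_nat)
  have "{b<..<2 * n} \<subseteq> x"
  proof
    fix t assume t: "t \<in> {b<..<2 * n}"
    then have "t \<in> y" using ab'(6) \<open>b' < b\<close> by auto
    moreover have "t \<notin> {a, b}" using t ab(2) by auto
    ultimately show "t \<in> x" using ab(1) by blast
  qed
  moreover have "y = x \<union> {a, b}" using ab c(2) by blast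
  moreover have "b < 2 * n" "1 \<le> a" using m alty(1) by (auto simp: alternating_def)
  ultimately show ?case using ab(2) m by blast
qed

text \<open>After the largest missing element \<open>b\<close> has been added, the next pair has its
  larger element below \<open>b\<close>, so no ascent can occur.\<close>

lemma critical_chain_ConsI:
  assumes "alternating n x" "a < b" "a \<notin> x" "b \<notin> x" "{b<..<2 * n} \<subseteq> x" "critical_chain n ((x \<union> {a, b}) # zs)"
  shows "critical_chain n (x # (x \<union> {a, b}) # zs)"
proof -
  let ?y = "x \<union> {a, b}"
  have "?y - x = {a, b}" using assms by auto
  then have "card (?y - x) = 2" using assms(2) by simp
  moreover have "\<not> ascent x ?y z" if zs: "zs = z # ws" for z ws
  proof -
    obtain a' b' where ab': "z = ?y \<union> {a', b'}" "b' \<notin> ?y" "b' < 2 * n"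
      using critical_chain_step[of n ?y z ws] assms(6) unfolding zs by blast
    then have "\<not> b < b'" using assms(5) by auto
    moreover have "b \<in> ?y - x" "b' \<in> z - ?y" using ab' assms by auto
    ultimately show ?thesis unfolding ascent_def by blast
  qed
  ultimately show ?thesis using assms by (cases zs) auto
qed

text \<open>A list of gap sizes encodes a member of a critical chain: reading downwards
  from the largest missing element, runs of \<open>2 * g\<close> missing elements alternate with single present
  ones, position 0 counting as present.\<close>

fun gap_len :: "nat list \<Rightarrow> nat" where
  "gap_len [] = 0"
| "gap_len (g # gs) = 2 * g + 1 + gap_len gs"

fun present :: "nat list \<Rightarrow> nat set" where
  "present [] = {}"
| "present (g # gs) = insert (gap_len gs) (present gs)"

definition gap_set :: "nat \<Rightarrow> nat list \<Rightarrow> nat set" where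
  "gap_set n gs = (present gs \<union> {gap_len gs..<2 * n}) - {0}"

lemma present_less: "t \<in> present gs \<Longrightarrow> t < gap_len gs"
  by (induction gs) auto

lemma gap_set_Nil: "gap_set n [] = full n"
  by (auto simp: gap_set_def full_def)

text \<open>An empty top gap joins the present positions above it. This is why a leaf leaves no
  trace in \<open>forest_chain\<close>.\<close>

lemma gap_set_0: "gap_len (0 # gs) \<le> 2 * n \<Longrightarrow> gap_set n (0 # gs) = gap_set n gs"
  by (auto simp: gap_set_def)

text \<open>The top gap has \<open>2 * (l + r + 1)\<close> positions. Its highest one is
  \<open>b\<close>; after adding \<open>a\<close> as well, \<open>2 * l\<close> positions stay
  missing below \<open>a\<close> and \<open>2 * r\<close> between \<open>a\<close> and
  \<open>b\<close>.\<close>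

lemma gap_set_split:
  assumes "gap_len (Suc (l + r) # gs) \<le> 2 * n"
  defines "a \<equiv> gap_len gs + 2 * l + 1" and "b \<equiv> gap_len gs + 2 * (l + r) + 2"
  shows "gap_set n (r # l # gs) = gap_set n (Suc (l + r) # gs) \<union> {a, b}"
    and "a \<notin> gap_set n (Suc (l + r) # gs)" "b \<notin> gap_set n (Suc (l + r) # gs)"
    and "a < b" "b < 2 * n" "{b<..<2 * n} \<subseteq> gap_set n (Suc (l + r) # gs)"
  using assms(1) by (auto simp: gap_set_def a_def b_def dest: present_less)

lemma gap_set_below:
  assumes "t \<in> gap_set n (Suc g # gs)" "t \<le> gap_len gs + 2 * g + 2"
  shows "t \<le> gap_len gs"
  using assms by (auto simp: gap_set_def dest: present_less)

text \<open>Nothing is present inside the top gap, so the count is the rank of its lower end, which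
  has the parity of that end. If the lower end is position 0, which is not an element, both numbers
  are zero.\<close>

lemma gap_set_card:
  assumes "alternating n (gap_set n (Suc g # gs))" "gap_len gs \<le> a" "a \<le> gap_len gs + 2 * g + 2"
  shows "even (card {s \<in> gap_set n (Suc g # gs). s \<le> a} + gap_len gs)"
proof -
  let ?T = "gap_set n (Suc g # gs)" and ?L = "gap_len gs"
  have e: "{s \<in> ?T. s \<le> a} = {s \<in> ?T. s \<le> ?L}"
    using gap_set_below[of _ n g gs] assms(2,3) by auto
  show ?thesis
  proof (cases "?L = 0")
    case True
    then have empty: "{s \<in> ?T. s \<le> a} = {}" unfolding e by (auto simp: gap_set_def)
    show ?thesis unfolding empty using True by simp
  next
    case False
    then have "?L \<in> ?T" by (simp add: gap_set_def)
    then show ?thesis unfolding e using assms(1) by (simp add: alternating_def)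
  qed
qed

lemma alternating_gap_set_split:
  assumes "gap_len (Suc (l + r) # gs) \<le> 2 * n" "alternating n (gap_set n (Suc (l + r) # gs))"
  shows "alternating n (gap_set n (r # l # gs))"
proof -
  note sp = gap_set_split[OF assms(1)]
  have "even (card {s \<in> gap_set n (Suc (l + r) # gs). s \<le> gap_len gs + 2 * l + 1} + gap_len gs)"
    by (rule gap_set_card[OF assms(2)]) auto
  then have o: "odd (card {s \<in> gap_set n (Suc (l + r) # gs). s \<le> gap_len gs + 2 * l + 1}
      + (gap_len gs + 2 * l + 1))"
    by simp
  show ?thesis unfolding sp(1)
  proof (rule alternating_insert_pair[OF assms(2) sp(4,5,2,3) _ _ o])
    fix t assume "t \<in> gap_set n (Suc (l + r) # gs)"
    then show "\<not> (gap_len gs + 2 * l + 1 < t \<and> t < gap_len gs + 2 * (l + r) + 2)"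
      using gap_set_below[of t n "l + r" gs] by auto
  qed auto
qed

text \<open>Here \<open>b\<close> must be the upper end of the top gap. If \<open>a\<close> lay
  below this gap, the lower end of the gap would separate \<open>a\<close> from \<open>b\<close>;
  and inside the gap the rank forces an odd distance from the lower end.\<close>

lemma gap_set_choice:
  assumes len: "gap_len (Suc g # gs) \<le> 2 * n" and alternating: "alternating n (gap_set n (Suc g # gs))"
    and alt': "alternating n (gap_set n (Suc g # gs) \<union> {a, b})"
    and ab: "a < b" "a \<notin> gap_set n (Suc g # gs)" "b \<notin> gap_set n (Suc g # gs)"
      "b < 2 * n" "{b<..<2 * n} \<subseteq> gap_set n (Suc g # gs)"
  shows "\<exists>l r. g = l + r \<and> gap_set n (Suc g # gs) \<union> {a, b} = gap_set n (r # l # gs)"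
proof -
  let ?T = "gap_set n (Suc g # gs)" and ?L = "gap_len gs"
  have fin: "finite ?T" using alternating by (rule alternating_finite)
  have "\<not> b < ?L + 2 * g + 2"
  proof
    assume h: "b < ?L + 2 * g + 2"
    then have "?L + 2 * g + 2 \<in> ?T" using ab(5) len by auto
    then show False using gap_set_below[of "?L + 2 * g + 2" n g gs] by simp
  qed
  moreover have "\<not> b > ?L + 2 * g + 2" using ab(3,4) by (auto simp: gap_set_def)
  ultimately have b: "b = ?L + 2 * g + 2" by simp
  have "1 \<le> a" using alt' by (auto simp: alternating_def)
  have La: "?L < a"
  proof (rule ccontr)
    assume h: "\<not> ?L < a"
    then have "?L \<in> ?T" using \<open>1 \<le> a\<close> by (auto simp: gap_set_def)
    moreover have "a \<noteq> ?L" using ab(2) calculation by auto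
    ultimately show False using alternating_insert_pairD[OF alternating alt' ab(1,2), of ?L] h b by auto
  qed
  have "{s \<in> ?T \<union> {a, b}. s \<le> a} = insert a {s \<in> ?T. s \<le> a}" using ab(1) by auto
  then have "card {s \<in> ?T \<union> {a, b}. s \<le> a} = Suc (card {s \<in> ?T. s \<le> a})" using fin ab(2) by simp
  moreover have "even (card {s \<in> ?T \<union> {a, b}. s \<le> a} + a)" using alt' by (auto simp: alternating_def)
  moreover have "even (card {s \<in> ?T. s \<le> a} + ?L)"
    by (rule gap_set_card[OF alternating]) (use La ab(1) b in auto)
  ultimately have "odd (a + ?L)" by auto
  then have "even (a - ?L - 1)" using La by auto
  then obtain l where "a - ?L - 1 = 2 * l" by (elim evenE)
  then have a: "a = ?L + 2 * l + 1" using La by simp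
  then have "l \<le> g" using ab(1) b by simp
  then obtain r where g: "g = l + r" using le_Suc_ex by blast
  have "?T \<union> {a, b} = gap_set n (r # l # gs)"
    using gap_set_split(1)[of l r gs n] len unfolding a b g by simp
  then show ?thesis using g by blast
qed

section \<open>The critical chain of a list of trees\<close>

text \<open>A tree with \<open>g\<close> internal vertices stands for a gap of \<open>2 * g\<close>
  positions and its root for the next splitting of that gap. The right subtree comes first because
  gaps are listed from above. Every call lowers \<open>gap_len\<close> by one.\<close>

function forest_chain :: "nat \<Rightarrow> pbtree list \<Rightarrow> nat set list" where
  "forest_chain n [] = [full n]"
| "forest_chain n (Leaf # ts) = forest_chain n ts"
| "forest_chain n (Node l r # ts) = gap_set n (map internal_vertices (Node l r # ts)) # forest_chain n (r # l # ts)"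
  by pat_completeness auto
termination
  by (relation "measure (\<lambda>(n, ts). gap_len (map internal_vertices ts))") auto

lemma forest_chain_critical_chain:
  assumes "n \<ge> 1" "gap_len (map internal_vertices ts) \<le> 2 * n"
    "alternating n (gap_set n (map internal_vertices ts))"
  shows "critical_chain n (forest_chain n ts) \<and> hd (forest_chain n ts) = gap_set n (map internal_vertices ts)"
  using assms
proof (induction n ts rule: forest_chain.induct)
  case (1 n)
  then show ?case by (simp add: gap_set_Nil)
next
  case (2 n ts)
  then show ?case using gap_set_0[of "map internal_vertices ts" n] by simp
next
  case (3 n l r ts)
  let ?gs = "map internal_vertices ts" and ?l = "internal_vertices l" and ?r = "internal_vertices r"
  have len: "gap_len (Suc (?l + ?r) # ?gs) \<le> 2 * n" and alternating: "alternating n (gap_set n (Suc (?l + ?r) # ?gs))"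
    using 3 by simp_all
  note sp = gap_set_split[OF len]
  have IH: "critical_chain n (forest_chain n (r # l # ts))" "hd (forest_chain n (r # l # ts)) = gap_set n (?r # ?l # ?gs)"
    using 3(1)[OF 3(2)] len alternating_gap_set_split[OF len alternating] by simp_all
  then obtain zs where zs: "forest_chain n (r # l # ts) = gap_set n (?r # ?l # ?gs) # zs"
    by (cases "forest_chain n (r # l # ts)") auto
  have "critical_chain n (gap_set n (Suc (?l + ?r) # ?gs) # gap_set n (?r # ?l # ?gs) # zs)"
    unfolding sp(1) by (rule critical_chain_ConsI) (use alternating sp IH(1) zs in auto)
  then show ?case using zs by simp
qed

text \<open>The second member of the chain shows where the top gap was split, hence the sizes of
  both subtrees; the induction then compares the remaining forests, which have equal sizes
  again.\<close>

lemma forest_chain_inj: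
  assumes "n \<ge> 1" "gap_len (map internal_vertices ts) \<le> 2 * n"
    "alternating n (gap_set n (map internal_vertices ts))"
    "map internal_vertices ts' = map internal_vertices ts" "forest_chain n ts' = forest_chain n ts"
  shows "ts' = ts"
  using assms
proof (induction n ts arbitrary: ts' rule: forest_chain.induct)
  case (1 n)
  then show ?case by simp
next
  case (2 n ts)
  from 2(5) obtain t ts'' where "ts' = t # ts''" "internal_vertices t = 0"
    "map internal_vertices ts'' = map internal_vertices ts" by (auto simp: map_eq_Cons_conv)
  moreover from this have "t = Leaf" by (cases t) auto
  ultimately show ?case using 2(1)[of ts''] 2(2-6) gap_set_0[of "map internal_vertices ts" n] by simp
next
  case (3 n l r ts)
  let ?gs = "map internal_vertices ts" and ?l = "internal_vertices l" and ?r = "internal_vertices r"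
  from 3(5) obtain t ts'' where t: "ts' = t # ts''" "internal_vertices t = Suc (?l + ?r)"
    "map internal_vertices ts'' = ?gs" by (auto simp: map_eq_Cons_conv)
  from t(2) obtain l' r' where lr: "t = Node l' r'" by (cases t) auto
  let ?l' = "internal_vertices l'" and ?r' = "internal_vertices r'"
  have s: "?l' + ?r' = ?l + ?r" using t(2) lr by simp
  have len: "gap_len (Suc (?l + ?r) # ?gs) \<le> 2 * n" and alternating: "alternating n (gap_set n (Suc (?l + ?r) # ?gs))"
    using 3(3,4) by simp_all
  have len': "gap_len (Suc (?l' + ?r') # ?gs) \<le> 2 * n" and alt': "alternating n (gap_set n (Suc (?l' + ?r') # ?gs))"
    using len alternating s by simp_all
  note sp = gap_set_split[OF len] and sp' = gap_set_split[OF len']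
  have d: "forest_chain n (r' # l' # ts'') = forest_chain n (r # l # ts)" using 3(6) t(1) lr by simp
  have "hd (forest_chain n (r # l # ts)) = gap_set n (?r # ?l # ?gs)"
    using forest_chain_critical_chain[OF 3(2), of "r # l # ts"] len alternating_gap_set_split[OF len alternating] by simp
  moreover have "hd (forest_chain n (r' # l' # ts'')) = gap_set n (?r' # ?l' # ?gs)"
    using forest_chain_critical_chain[OF 3(2), of "r' # l' # ts''"] len' alternating_gap_set_split[OF len' alt'] t(3) by simp
  ultimately have "gap_set n (?r' # ?l' # ?gs) = gap_set n (?r # ?l # ?gs)" using d by simp
  then have "gap_len ?gs + 2 * ?l' + 1 \<in> gap_set n (Suc (?l + ?r) # ?gs)
      \<union> {gap_len ?gs + 2 * ?l + 1, gap_len ?gs + 2 * (?l + ?r) + 2}"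
    unfolding sp(1) sp'(1) by blast
  moreover have "gap_len ?gs + 2 * ?l' + 1 \<notin> gap_set n (Suc (?l + ?r) # ?gs)" using sp'(2) s by simp
  \<comment> \<open>By parity the smaller element of one splitting is never the larger one of the
    other.\<close>
  moreover have "gap_len ?gs + 2 * ?l' + 1 \<noteq> gap_len ?gs + 2 * (?l + ?r) + 2" by presburger
  ultimately have "?l' = ?l" by simp
  then have "?r' = ?r" using s by simp
  have "r' # l' # ts'' = r # l # ts"
    by (rule 3(1)[OF 3(2)]) (use len alternating_gap_set_split[OF len alternating] t(3) \<open>?l' = ?l\<close> \<open>?r' = ?r\<close> d in simp_all)
  then show ?case using t(1) lr by simp
qed

text \<open>An empty top gap yields a leaf. Otherwise the next member of the chain adds the largest
  missing element, and \<open>gap_set_choice\<close> reads the sizes of the two subtrees from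
  it.\<close>

lemma forest_chain_surj:
  assumes "critical_chain n u" "hd u = gap_set n gs" "gap_len gs \<le> 2 * n"
  shows "\<exists>ts. map internal_vertices ts = gs \<and> forest_chain n ts = u"
  using assms
proof (induction "gap_len gs" arbitrary: gs u rule: less_induct)
  case less
  show ?case
  proof (cases gs)
    case Nil
    have "u = [full n]"
    proof (cases "(n, u)" rule: critical_chain.cases)
      case (3 n' x y zs)
      have "x = full n" using less(3) 3 Nil gap_set_Nil by simp
      moreover have "x \<subset> y" "y \<subseteq> full n"
        using less(2) 3 critical_chain_iff[of n u] alternating_chain_subset_last[of n u y] by auto
      ultimately show ?thesis by blast
    qed (use less(2) in auto)
    then show ?thesis using Nil by (intro exI[of _ "[]"]) simp
  next
    case (Cons g gs')
    show ?thesis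
    proof (cases g)
      case 0
      then obtain ts where "map internal_vertices ts = gs'" "forest_chain n ts = u"
        using less(1)[of gs' u] less(2-4) Cons gap_set_0[of gs' n] by auto
      then show ?thesis using 0 Cons by (intro exI[of _ "Leaf # ts"]) simp
    next
      case (Suc k)
      have len: "gap_len (Suc k # gs') \<le> 2 * n" using less(4) Cons Suc by simp
      have hd: "hd u = gap_set n (Suc k # gs')" using less(3) Cons Suc by simp
      have "gap_len gs' + 2 * k + 2 \<notin> hd u" using gap_set_below[of "gap_len gs' + 2 * k + 2" n k gs'] hd by auto
      moreover have "gap_len gs' + 2 * k + 2 \<in> full n" using len by (simp add: full_def)
      ultimately obtain y zs where u: "u = gap_set n (Suc k # gs') # y # zs"
        using less(2) hd by (cases u; cases "tl u") auto
      obtain a b where ab: "a < b" "y = gap_set n (Suc k # gs') \<union> {a, b}" "a \<notin> gap_set n (Suc k # gs')"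
        "b \<notin> gap_set n (Suc k # gs')" "b < 2 * n" "{b<..<2 * n} \<subseteq> gap_set n (Suc k # gs')"
        using critical_chain_step[of n "gap_set n (Suc k # gs')" y zs] less(2) u by blast
      have cy: "critical_chain n (y # zs)" "alternating n (gap_set n (Suc k # gs'))" using less(2) u by auto
      have "alternating n y" using cy by (cases zs) auto
      then obtain l r where lr: "k = l + r" "y = gap_set n (r # l # gs')"
        using gap_set_choice[OF len cy(2) _ ab(1,3-6)] ab(2) by auto
      have "gap_len (r # l # gs') < gap_len gs" "gap_len (r # l # gs') \<le> 2 * n"
        using Cons Suc lr(1) len by simp_all
      moreover have "hd (y # zs) = gap_set n (r # l # gs')" using lr(2) by simp
      ultimately obtain ts where ts: "map internal_vertices ts = r # l # gs'" "forest_chain n ts = y # zs"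
        using less(1)[of "r # l # gs'" "y # zs"] cy(1) by metis
      from ts(1) obtain tr tl ts' where "ts = tr # tl # ts'" by (cases ts; cases "List.tl ts") auto
      then show ?thesis using ts u Cons Suc lr by (intro exI[of _ "Node tl tr # ts'"]) auto
    qed
  qed
qed

section \<open>Planar binary trees and critical chains\<close>

text \<open>The root does not stand for a step: it is the splitting of all positions by the least
  member \<open>{2 * p + 1}\<close> of the chain, with \<open>2 * p\<close> positions below for the
  left subtree and the rest above for the right one. The set before that splitting would be empty
  and is not alternating.\<close>

fun tree_chain :: "nat \<Rightarrow> pbtree \<Rightarrow> nat set list" where
  "tree_chain n Leaf = []"
| "tree_chain n (Node l r) = forest_chain n [r, l]"

lemma alternating_singleton: "p < n \<Longrightarrow> alternating n {2 * p + 1}"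
proof -
  have "{s. s = Suc (2 * p) \<and> s \<le> Suc (2 * p)} = {Suc (2 * p)}" by auto
  then show "p < n \<Longrightarrow> alternating n {2 * p + 1}" by (auto simp: alternating_def)
qed

lemma alternating_card_1:
  assumes "alternating n T" "card T = 1"
  obtains p where "p < n" "T = {2 * p + 1}"
proof -
  obtain t where t: "T = {t}" using assms(2) by (auto simp: card_1_singleton_iff)
  have "{s. s = t \<and> s \<le> t} = {t}" by auto
  then have "odd t" "t < 2 * n" using assms(1) t by (auto simp: alternating_def)
  then obtain p where "t = 2 * p + 1" by (elim oddE)
  then show ?thesis using that[of p] t \<open>t < 2 * n\<close> by simp
qed

lemma critical_chains_iff: "n \<ge> 1 \<Longrightarrow> u \<in> critical_chains n \<longleftrightarrow> critical_chain n u \<and> card (hd u) = 1"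
proof -
  assume n: "n \<ge> 1"
  have "length u = Suc (n - 1)" if "critical_chain n u" "card (hd u) = 1"
  proof -
    have "u \<noteq> []" using that by auto
    moreover have "1 + 2 * (length u - 1) = 2 * n - 1"
      using alternating_chain_card_le(3)[of n u] that critical_chain_iff by auto
    ultimately show ?thesis using n by (cases u) auto
  qed
  then show ?thesis by (auto simp: critical_chains_def alternating_chains_def critical_chain_iff)
qed

lemma tree_chain_bij:
  assumes "n \<ge> 1" shows "bij_betw (tree_chain n) (Y n) (critical_chains n)"
proof -
  have gs: "gap_set n [r, l] = {2 * l + 1}" "gap_len [r, l] = 2 * n" "alternating n (gap_set n [r, l])"
    if "Suc (l + r) = n" for l r
  proof -
    show e: "gap_set n [r, l] = {2 * l + 1}" "gap_len [r, l] = 2 * n"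
      using that by (auto simp: gap_set_def)
    show "alternating n (gap_set n [r, l])" unfolding e by (rule alternating_singleton) (use that in simp)
  qed
  show ?thesis
    unfolding bij_betw_def
  proof
    show "inj_on (tree_chain n) (Y n)"
    proof (rule inj_onI)
      fix s t assume st: "s \<in> Y n" "t \<in> Y n" "tree_chain n s = tree_chain n t"
      obtain l r where s: "s = Node l r" "Suc (internal_vertices l + internal_vertices r) = n"
        using st(1) assms by (cases s) (auto simp: Y_def)
      obtain l' r' where t: "t = Node l' r'" "Suc (internal_vertices l' + internal_vertices r') = n"
        using st(2) assms by (cases t) (auto simp: Y_def)
      note g = gs[OF s(2)] and g' = gs[OF t(2)]
      have eq: "forest_chain n [r, l] = forest_chain n [r', l']" using st(3) s t by simp
      have "hd (forest_chain n [r, l]) = {2 * internal_vertices l + 1}"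
        using forest_chain_critical_chain[OF assms, of "[r, l]"] g by simp
      moreover have "hd (forest_chain n [r', l']) = {2 * internal_vertices l' + 1}"
        using forest_chain_critical_chain[OF assms, of "[r', l']"] g' by simp
      ultimately have l: "internal_vertices l = internal_vertices l'" using eq by simp
      then have "internal_vertices r = internal_vertices r'" using s t by simp
      then have "[r, l] = [r', l']" using forest_chain_inj[OF assms, of "[r', l']" "[r, l]"] g' l eq by simp
      then show "s = t" using s t by simp
    qed
    show "tree_chain n ` Y n = critical_chains n"
    proof (intro equalityI subsetI)
      fix u assume "u \<in> tree_chain n ` Y n"
      then obtain t where t: "t \<in> Y n" "u = tree_chain n t" by blast
      then obtain l r where lr: "t = Node l r" "Suc (internal_vertices l + internal_vertices r) = n"
        using assms by (cases t) (auto simp: Y_def)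
      then show "u \<in> critical_chains n"
        using forest_chain_critical_chain[OF assms, of "[r, l]"] gs[OF lr(2)] t(2) critical_chains_iff[OF assms] by simp
    next
      fix u assume u: "u \<in> critical_chains n"
      then have c: "critical_chain n u" "card (hd u) = 1" using critical_chains_iff[OF assms] by auto
      have "alternating n (hd u)" using c(1) alternating_chain_alternating[of n u "hd u"] by (cases u) (auto simp: critical_chain_iff)
      then obtain p where p: "p < n" "hd u = {2 * p + 1}" using alternating_card_1 c(2) by blast
      have s: "Suc (p + (n - 1 - p)) = n" using p(1) by simp
      have h: "hd u = gap_set n [n - 1 - p, p]" "gap_len [n - 1 - p, p] \<le> 2 * n"
        using gs(1,2)[OF s] p(2) by (simp_all only: order_refl)
      obtain ts where ts: "map internal_vertices ts = [n - 1 - p, p]" "forest_chain n ts = u"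
        using forest_chain_surj[OF c(1) h] by metis
      have "length (map internal_vertices ts) = Suc (Suc 0)" unfolding ts(1) by simp
      then have "length ts = Suc (Suc 0)" by simp
      then obtain r l where "ts = [r, l]" by (auto simp: length_Suc_conv)
      then show "u \<in> tree_chain n ` Y n"
        using ts s by (intro image_eqI[of _ _ "Node l r"]) (auto simp: Y_def)
    qed
  qed
qed

section \<open>Alternating sets as pointed ordered partitions\<close>

text \<open>Both ends of the word are cuts of every set; their codes 0 and \<open>2 * n\<close> lie
  outside \<open>{1..<2 * n}\<close> and are therefore supplied here.\<close>

definition cut :: "nat \<Rightarrow> nat set \<Rightarrow> nat \<Rightarrow> bool" where
  "cut n T c \<longleftrightarrow> c = 0 \<or> c = n \<or> 2 * c \<in> T"

definition block_range :: "nat \<Rightarrow> nat set \<Rightarrow> nat \<Rightarrow> nat \<Rightarrow> bool" where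
  "block_range n T c d \<longleftrightarrow> cut n T c \<and> cut n T d \<and> c < d \<and> (\<forall>e. c < e \<and> e < d \<longrightarrow> 2 * e \<notin> T)"

definition segment :: "(nat \<Rightarrow> nat) \<Rightarrow> nat \<Rightarrow> nat \<Rightarrow> nat list" where
  "segment \<tau> c d = map \<tau> [Suc c..<Suc d]"

text \<open>The element in position \<open>q\<close> (counted from 0) of the word \<open>\<tau> 1, \<dots>, \<tau> n\<close> is pointed iff
  \<open>2 * q + 1 \<in> T\<close>; a block ends after the first \<open>c\<close> letters iff \<open>2 * c \<in> T\<close>.\<close>

definition ppart_of :: "nat \<Rightarrow> (nat \<Rightarrow> nat) \<Rightarrow> nat set \<Rightarrow> ppart" where
  "ppart_of n \<tau> T = {(segment \<tau> c d, \<tau> (Suc q)) | c d q. block_range n T c d \<and> 2 * q + 1 \<in> T \<and> c \<le> q \<and> q < d}"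

lemma set_segment: "set (segment \<tau> c d) = \<tau> ` {c<..d}"
  by (auto simp: segment_def)

lemma segment_append: "c \<le> d \<Longrightarrow> d \<le> e \<Longrightarrow> segment \<tau> c d @ segment \<tau> d e = segment \<tau> c e"
  unfolding segment_def map_append[symmetric]
  by (metis le_add_diff_inverse map_append upt_add_eq_append Suc_le_mono plus_nat.simps(2) le_iff_add)

lemma segment_self: "segment \<tau> c c = []"
  by (simp add: segment_def)

lemma last_segment: "c < d \<Longrightarrow> last (segment \<tau> c d) = \<tau> d"
  by (simp add: segment_def)

lemma length_segment: "length (segment \<tau> c d) = d - c"
  by (auto simp: segment_def)

lemma take_segment: "k \<le> n \<Longrightarrow> take k (segment \<tau> 0 n) = segment \<tau> 0 k"
  by (simp add: segment_def take_map take_upt del: upt_Suc)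

lemma cut_le: "T \<subseteq> {1..<2 * n} \<Longrightarrow> cut n T c \<Longrightarrow> c \<le> n"
  by (auto simp: cut_def)

lemma cut_inner: "T \<subseteq> {1..<2 * n} \<Longrightarrow> block_range n T c d \<Longrightarrow> cut n T e \<Longrightarrow> \<not> (c < e \<and> e < d)"
  using cut_le[of T n d] by (auto simp: block_range_def cut_def)

lemma block_range_unique:
  assumes "T \<subseteq> {1..<2 * n}" "block_range n T c d" "block_range n T c' d'" "c < i" "i \<le> d" "c' < i" "i \<le> d'"
  shows "c = c' \<and> d = d'"
proof -
  have "cut n T c" "cut n T d" "cut n T c'" "cut n T d'" using assms(2,3) by (auto simp: block_range_def)
  then have "\<not> (c < c' \<and> c' < d)" "\<not> (c' < c \<and> c < d')" "\<not> (c < d' \<and> d' < d)" "\<not> (c' < d \<and> d < d')"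
    using assms(1-3) cut_inner by blast+
  then show ?thesis using assms(4-7) by linarith
qed

lemma block_range_exists:
  assumes "q < n"
  shows "\<exists>c d. block_range n T c d \<and> c \<le> q \<and> q < d"
proof -
  let ?C = "{c. c \<le> q \<and> cut n T c}"
  have C: "finite ?C" "0 \<in> ?C" by (auto simp: cut_def)
  then have c: "Max ?C \<in> ?C" using Max_in by blast
  have n: "q < n \<and> cut n T n" using assms by (simp add: cut_def)
  define d where "d = (LEAST d. q < d \<and> cut n T d)"
  have d: "q < d \<and> cut n T d" unfolding d_def using n by (rule LeastI)
  have "2 * e \<notin> T" if e: "Max ?C < e" "e < d" for e
  proof
    assume "2 * e \<in> T"
    then have "cut n T e" by (simp add: cut_def)
    moreover have "\<not> (q < e \<and> cut n T e)" using not_less_Least[of e] e(2) unfolding d_def by blast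
    ultimately have "e \<in> ?C" by (simp add: not_less)
    then show False using Max_ge[OF C(1)] e(1) by (meson not_le)
  qed
  then show ?thesis using c d by (intro exI[of _ "Max ?C"] exI[of _ d]) (auto simp: block_range_def)
qed

lemma block_range_ending_at:
  assumes "T \<subseteq> {1..<2 * n}" "cut n T d" "0 < d"
  shows "\<exists>c. block_range n T c d"
proof -
  have "d - 1 < n" using cut_le[OF assms(1,2)] assms(3) by linarith
  then obtain c e where ce: "block_range n T c e" "c \<le> d - 1" "d - 1 < e" using block_range_exists by blast
  then have "\<not> (c < d \<and> d < e)" using cut_inner assms by blast
  then have "e = d" using ce assms(3) by linarith
  then show ?thesis using ce by blast
qed

lemma block_range_starting_at:
  assumes "T \<subseteq> {1..<2 * n}" "cut n T c" "c < n"
  shows "\<exists>d. block_range n T c d"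
proof -
  obtain b d where boundary: "block_range n T b d" "b \<le> c" "c < d" using block_range_exists[OF assms(3)] by blast
  then have "\<not> (b < c \<and> c < d)" using cut_inner assms by blast
  then have "b = c" using boundary by linarith
  then show ?thesis using boundary by blast
qed

text \<open>The successor of the lower of two points would be even and code a cut strictly inside
  the block.\<close>

lemma block_range_point_unique:
  assumes "alternating n T" "block_range n T c d" "2 * q + 1 \<in> T" "c \<le> q" "q < d" "2 * q' + 1 \<in> T" "c \<le> q'" "q' < d"
  shows "q = q'"
proof -
  have *: "\<not> r < r'" if r: "2 * r + 1 \<in> T" "c \<le> r" "r < d" "2 * r' + 1 \<in> T" "c \<le> r'" "r' < d" for r r'
  proof
    assume "r < r'"
    then obtain t where t: "t \<in> T" "2 * r + 1 < t" "t \<le> 2 * r' + 1" "odd (2 * r + 1 + t)"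
      using alternating_next[OF assms(1) r(1,4)] by auto
    then have "even t" by simp
    then obtain e where "t = 2 * e" by (elim evenE)
    then show False using t r assms(2) by (auto simp: block_range_def)
  qed
  show ?thesis using *[of q q'] *[of q' q] assms by linarith
qed

text \<open>Without a point no element lies strictly between \<open>2 * c\<close> and
  \<open>2 * d\<close>, so their ranks differ by one although both are even. At the right end
  \<open>d = n\<close> the odd size of \<open>T\<close> replaces the rank of
  \<open>2 * d\<close>.\<close>

lemma block_range_point_exists:
  assumes "alternating n T" "block_range n T c d"
  shows "\<exists>q. 2 * q + 1 \<in> T \<and> c \<le> q \<and> q < d"
proof (rule ccontr)
  assume none: "\<not> ?thesis"
  have sub: "T \<subseteq> {1..<2 * n}" and fin: "finite T"
    using assms(1) alternating_finite[OF assms(1)] by (simp_all add: alternating_def)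
  have b: "cut n T c" "cut n T d" "c < d" "\<And>e. c < e \<Longrightarrow> e < d \<Longrightarrow> 2 * e \<notin> T"
    using assms(2) by (auto simp: block_range_def)
  have dn: "d \<le> n" using cut_le[OF sub b(2)] .
  have gap: "t \<le> 2 * c" if "t \<in> T" "t < 2 * d" for t
  proof (rule ccontr)
    assume h: "\<not> t \<le> 2 * c"
    show False
    proof (cases "even t")
      case True
      then obtain e where "t = 2 * e" by (elim evenE)
      then show False using b(4)[of e] that h by auto
    next
      case False
      then obtain q where q: "t = 2 * q + 1" by (elim oddE)
      then have "c \<le> q" "q < d" using that(2) h by linarith+
      then show False using none that(1) q by blast
    qed
  qed
  let ?A = "{s \<in> T. s \<le> 2 * c}"
  have A: "even (card ?A)"
  proof (cases "c = 0")
    case True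
    then have e: "?A = {}" using sub by auto
    show ?thesis unfolding e by simp
  next
    case False
    then have "2 * c \<in> T" using b dn by (auto simp: cut_def)
    then show ?thesis using assms(1) by (auto simp: alternating_def)
  qed
  show False
  proof (cases "d = n")
    case True
    then have "?A = T" using gap sub by auto
    then show False using A assms(1) by (simp add: alternating_def)
  next
    case False
    then have d: "2 * d \<in> T" using b by (auto simp: cut_def)
    have "t = 2 * d" if "t \<in> T" "t \<le> 2 * d" "\<not> t \<le> 2 * c" for t using gap that by (meson le_neq_implies_less)
    then have "{s \<in> T. s \<le> 2 * d} = insert (2 * d) ?A" using d b(3) by auto
    then have "card {s \<in> T. s \<le> 2 * d} = Suc (card ?A)" using fin b(3) by simp
    moreover have "even (card {s \<in> T. s \<le> 2 * d} + 2 * d)" using d assms(1) by (simp only: alternating_def)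
    ultimately show False using A by simp
  qed
qed

lemma permutes_eq_iff: "\<tau> permutes A \<Longrightarrow> \<tau> i = \<tau> j \<longleftrightarrow> i = j"
  by (metis permutes_inj inj_eq)

section \<open>The order of alternating sets as the order above a word\<close>

lemma ppart_of_PO:
  assumes "\<tau> permutes {1..n}" "alternating n T"
  shows "ppart_of n \<tau> T \<in> PO n"
proof -
  note inj = permutes_eq_iff[OF assms(1)]
  have sub: "T \<subseteq> {1..<2 * n}" using assms(2) by (simp add: alternating_def)
  have "ppart_of n \<tau> T \<subseteq> (\<lambda>(c, d, q). (segment \<tau> c d, \<tau> (Suc q))) ` ({..n} \<times> {..n} \<times> {..n})"
  proof
    fix b assume "b \<in> ppart_of n \<tau> T"
    then obtain c d q where h: "b = (segment \<tau> c d, \<tau> (Suc q))" "block_range n T c d" "c \<le> q" "q < d"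
      unfolding ppart_of_def by blast
    moreover have "d \<le> n" using cut_le[OF sub] h(2) by (auto simp: block_range_def)
    ultimately show "b \<in> (\<lambda>(c, d, q). (segment \<tau> c d, \<tau> (Suc q))) ` ({..n} \<times> {..n} \<times> {..n})"
      by (intro image_eqI[of _ _ "(c, d, q)"]) auto
  qed
  then have fin: "finite (ppart_of n \<tau> T)" by (rule finite_subset) auto
  have good: "xs \<noteq> [] \<and> distinct xs \<and> p \<in> set xs" if xp: "(xs, p) \<in> ppart_of n \<tau> T" for xs p
  proof -
    obtain c d q where h: "xs = segment \<tau> c d" "p = \<tau> (Suc q)" "c \<le> q" "q < d"
      using xp unfolding ppart_of_def by blast
    have "distinct xs" unfolding h(1) segment_def by (simp add: distinct_map inj_on_def inj del: upt_Suc)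
    moreover have "p \<in> set xs" using h by (auto simp: set_segment)
    ultimately show ?thesis by auto
  qed
  have disj: "set (fst b1) \<inter> set (fst b2) = {}"
    if b: "b1 \<in> ppart_of n \<tau> T" "b2 \<in> ppart_of n \<tau> T" "b1 \<noteq> b2" for b1 b2
  proof (rule ccontr)
    assume ne: "set (fst b1) \<inter> set (fst b2) \<noteq> {}"
    obtain c d q where h: "b1 = (segment \<tau> c d, \<tau> (Suc q))" "block_range n T c d" "2 * q + 1 \<in> T" "c \<le> q" "q < d"
      using b(1) unfolding ppart_of_def by blast
    obtain c' d' q' where h': "b2 = (segment \<tau> c' d', \<tau> (Suc q'))" "block_range n T c' d'" "2 * q' + 1 \<in> T" "c' \<le> q'" "q' < d'"
      using b(2) unfolding ppart_of_def by blast
    obtain i where "c < i" "i \<le> d" "c' < i" "i \<le> d'" using ne h(1) h'(1) by (auto simp: set_segment inj)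
    then have "c = c'" "d = d'" using block_range_unique[OF sub h(2) h'(2)] by auto
    then show False using block_range_point_unique[OF assms(2) h(2-5), of q'] h h' b(3) by auto
  qed
  have "(\<Union>b\<in>ppart_of n \<tau> T. set (fst b)) = \<tau> ` {1..n}"
  proof (intro equalityI subsetI)
    fix x assume "x \<in> (\<Union>b\<in>ppart_of n \<tau> T. set (fst b))"
    then obtain c d where h: "x \<in> set (segment \<tau> c d)" "block_range n T c d" unfolding ppart_of_def by auto
    moreover have "d \<le> n" using cut_le[OF sub] h(2) by (auto simp: block_range_def)
    ultimately show "x \<in> \<tau> ` {1..n}" by (auto simp: set_segment)
  next
    fix x assume "x \<in> \<tau> ` {1..n}"
    then obtain i where i: "x = \<tau> i" "1 \<le> i" "i \<le> n" by auto
    then have "i - 1 < n" by simp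
    then obtain c d where cd: "block_range n T c d" "c \<le> i - 1" "i - 1 < d" using block_range_exists by blast
    obtain q where "2 * q + 1 \<in> T" "c \<le> q" "q < d" using block_range_point_exists[OF assms(2) cd(1)] by blast
    then have "(segment \<tau> c d, \<tau> (Suc q)) \<in> ppart_of n \<tau> T" using cd(1) unfolding ppart_of_def by blast
    moreover have "c < i" "i \<le> d" using i cd by auto
    then have "x \<in> set (segment \<tau> c d)" using i by (simp add: set_segment)
    ultimately show "x \<in> (\<Union>b\<in>ppart_of n \<tau> T. set (fst b))" by force
  qed
  then show ?thesis using fin good disj permutes_image[OF assms(1)] unfolding PO_def is_ppart_def by auto
qed

lemma snd_ppart_of:
  assumes "alternating n T"
  shows "snd ` ppart_of n \<tau> T = {\<tau> (Suc q) | q. 2 * q + 1 \<in> T}"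
proof (intro equalityI subsetI)
  fix x assume "x \<in> {\<tau> (Suc q) | q. 2 * q + 1 \<in> T}"
  then obtain q where q: "x = \<tau> (Suc q)" "2 * q + 1 \<in> T" by blast
  then have "q < n" using assms by (auto simp: alternating_def)
  then obtain c d where "block_range n T c d" "c \<le> q" "q < d" using block_range_exists by blast
  then have "(segment \<tau> c d, \<tau> (Suc q)) \<in> ppart_of n \<tau> T" using q unfolding ppart_of_def by blast
  then show "x \<in> snd ` ppart_of n \<tau> T" using q by force
qed (auto simp: ppart_of_def)

lemma block_range_segment_in: "alternating n T \<Longrightarrow> block_range n T c d \<Longrightarrow> segment \<tau> c d \<in> fst ` ppart_of n \<tau> T"
  using block_range_point_exists[of n T c d] unfolding ppart_of_def by force

lemma segment_concat:
  assumes "alternating n T" "cut n T c" "cut n T d" "c \<le> d"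
  shows "\<exists>bs. set bs \<subseteq> fst ` ppart_of n \<tau> T \<and> concat bs = segment \<tau> c d"
  using assms(2,4)
proof (induction "d - c" arbitrary: c rule: less_induct)
  case less
  have sub: "T \<subseteq> {1..<2 * n}" using assms(1) by (simp add: alternating_def)
  show ?case
  proof (cases "c = d")
    case True
    then show ?thesis by (intro exI[of _ "[]"]) (simp add: segment_self)
  next
    case False
    then have cd: "c < d" using less by simp
    then have "c < n" using cut_le[OF sub assms(3)] by simp
    then obtain e where e: "block_range n T c e" using block_range_starting_at[OF sub less(2)] by blast
    have "\<not> (c < d \<and> d < e)" using cut_inner[OF sub e assms(3)] .
    then have "e \<le> d" "c < e" "cut n T e" using cd e by (auto simp: block_range_def)
    then obtain bs where bs: "set bs \<subseteq> fst ` ppart_of n \<tau> T" "concat bs = segment \<tau> e d"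
      using less(1)[of e] cd by (metis diff_less_mono2)
    then show ?thesis
      using block_range_segment_in[OF assms(1) e, of \<tau>] segment_append[of c e d \<tau>] \<open>c < e\<close> \<open>e \<le> d\<close>
      by (intro exI[of _ "segment \<tau> c e # bs"]) auto
  qed
qed

lemma po_le_ppart_of:
  assumes "alternating n T" "alternating n T'" "T \<subseteq> T'"
  shows "po_le (ppart_of n \<tau> T) (ppart_of n \<tau> T')"
proof -
  have sub: "T \<subseteq> {1..<2 * n}" using assms(1) by (simp add: alternating_def)
  have "\<exists>bs. set bs \<subseteq> fst ` ppart_of n \<tau> T' \<and> concat bs = xs" if xp: "(xs, p) \<in> ppart_of n \<tau> T" for xs p
  proof -
    obtain c d where cd: "xs = segment \<tau> c d" "block_range n T c d" using xp unfolding ppart_of_def by blast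
    have "cut n T' c" "cut n T' d" "c \<le> d" using cd(2) assms(3) by (auto simp: block_range_def cut_def)
    then show ?thesis using segment_concat[OF assms(2)] cd(1) by blast
  qed
  moreover have "snd ` ppart_of n \<tau> T \<subseteq> snd ` ppart_of n \<tau> T'"
    using assms(3) unfolding snd_ppart_of[OF assms(1)] snd_ppart_of[OF assms(2)] by blast
  ultimately show ?thesis unfolding po_le_def by blast
qed

lemma last_concat: "xss \<noteq> [] \<Longrightarrow> [] \<notin> set xss \<Longrightarrow> last (concat xss) = last (last xss)"
  by (induction xss rule: rev_induct) auto

lemma PO_block_eq:
  assumes "Q \<in> PO n" "b \<in> Q" "b' \<in> Q" "x \<in> set (fst b)" "x \<in> set (fst b')"
  shows "b = b'"
  using assms unfolding PO_def is_ppart_def by blast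

lemma PO_blockD:
  assumes "Q \<in> PO n" "(xs, p) \<in> Q"
  shows "xs \<noteq> []" "distinct xs" "p \<in> set xs" "set xs \<subseteq> {1..n}"
  using assms unfolding PO_def is_ppart_def by force+

lemma PO_cover: "Q \<in> PO n \<Longrightarrow> i \<in> {1..n} \<Longrightarrow> \<exists>xs p. (xs, p) \<in> Q \<and> i \<in> set xs"
proof -
  assume "Q \<in> PO n" "i \<in> {1..n}"
  then have "i \<in> (\<Union>b\<in>Q. set (fst b))" unfolding PO_def is_ppart_def by simp
  then obtain b where "b \<in> Q" "i \<in> set (fst b)" by blast
  then show ?thesis by (intro exI[of _ "fst b"] exI[of _ "snd b"]) simp
qed

text \<open>Points can be compared directly. For a cut after \<open>d\<close> letters, the block
  that ends there is a concatenation of finer blocks, and the last of these ends with the same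
  letter.\<close>

lemma po_le_ppart_ofD:
  assumes "\<tau> permutes {1..n}" "alternating n T" "alternating n T'" "po_le (ppart_of n \<tau> T) (ppart_of n \<tau> T')"
  shows "T \<subseteq> T'"
proof
  note inj = permutes_eq_iff[OF assms(1)]
  have sub: "T \<subseteq> {1..<2 * n}" using assms(2) by (simp add: alternating_def)
  fix t assume t: "t \<in> T"
  show "t \<in> T'"
  proof (cases "even t")
    case False
    then obtain q where q: "t = 2 * q + 1" by (elim oddE)
    then have "\<tau> (Suc q) \<in> snd ` ppart_of n \<tau> T" using t unfolding snd_ppart_of[OF assms(2)] by blast
    then have "\<tau> (Suc q) \<in> snd ` ppart_of n \<tau> T'" using assms(4) by (auto simp: po_le_def)
    then show ?thesis unfolding snd_ppart_of[OF assms(3)] using q by (auto simp: inj)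
  next
    case True
    then obtain d where d: "t = 2 * d" by (elim evenE)
    then have d0: "0 < d" "d < n" "cut n T d" using t sub by (auto simp: cut_def)
    then obtain c where c: "block_range n T c d" using block_range_ending_at[OF sub] by blast
    then have "c < d" by (simp add: block_range_def)
    obtain b where "b \<in> ppart_of n \<tau> T" "fst b = segment \<tau> c d" using block_range_segment_in[OF assms(2) c, of \<tau>] by force
    then obtain bs where bs: "set bs \<subseteq> fst ` ppart_of n \<tau> T'" "concat bs = segment \<tau> c d"
      using assms(4) unfolding po_le_def by force
    have ne: "bs \<noteq> []" using bs(2) length_segment[of \<tau> c d] \<open>c < d\<close> by auto
    have "[] \<notin> set bs"
    proof
      assume "[] \<in> set bs"
      then obtain p where "([], p) \<in> ppart_of n \<tau> T'" using bs(1) by auto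
      then show False using PO_blockD(1)[OF ppart_of_PO[OF assms(1,3)]] by blast
    qed
    then have l: "last (last bs) = \<tau> d" using last_concat[OF ne] bs(2) last_segment[OF \<open>c < d\<close>] by simp
    have "last bs \<in> fst ` ppart_of n \<tau> T'" using bs(1) ne by auto
    then obtain c' d' where "last bs = segment \<tau> c' d'" "block_range n T' c' d'" unfolding ppart_of_def by auto
    then have "\<tau> d' = \<tau> d" "cut n T' d'" using l last_segment[of c' d' \<tau>] by (auto simp: block_range_def)
    then show ?thesis using d0 d by (auto simp: inj cut_def)
  qed
qed

lemma ppart_of_inj:
  assumes "\<tau> permutes {1..n}" "alternating n T" "alternating n T'" "ppart_of n \<tau> T = ppart_of n \<tau> T'"
  shows "T = T'"
proof
  have "po_le (ppart_of n \<tau> T) (ppart_of n \<tau> T)" by (rule po_le_ppart_of[OF assms(2,2)]) simp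
  then show "T \<subseteq> T'" using po_le_ppart_ofD[OF assms(1-3)] assms(4) by simp
  have "po_le (ppart_of n \<tau> T') (ppart_of n \<tau> T')" by (rule po_le_ppart_of[OF assms(3,3)]) simp
  then show "T' \<subseteq> T" using po_le_ppart_ofD[OF assms(1,3,2)] assms(4) by simp
qed

lemma segment_full_set: "\<tau> permutes {1..n} \<Longrightarrow> set (segment \<tau> 0 n) = {1..n}"
  using permutes_image[of \<tau> "{1..n}"] by (simp add: set_segment atLeastSucAtMost_greaterThanAtMost[symmetric])

text \<open>The converse to \<open>ppart_of_PO\<close>: a partition whose blocks spell the word
  comes from a set. The set is read off from letters, and its ranks have the right parity because
  each block contributes one point, followed by one cut unless the word ends.\<close>

lemma ppart_of_exists:
  assumes n: "n \<ge> 1" and perm: "\<tau> permutes {1..n}" and Q: "Q \<in> PO n"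
    and bs: "set bs \<subseteq> fst ` Q" "concat bs = segment \<tau> 0 n"
  shows "\<exists>T. alternating n T \<and> Q = ppart_of n \<tau> T"
proof -
  note inj = permutes_eq_iff[OF perm]
  \<comment> \<open>A cut is recognised by the last letter of a block. The end of the word is
    excluded, since \<open>cut\<close> supplies it.\<close>
  define T where "T = {2 * q + 1 | q. q < n \<and> \<tau> (Suc q) \<in> snd ` Q} \<union>
    {2 * c | c. 0 < c \<and> c < n \<and> \<tau> c \<in> (\<lambda>b. last (fst b)) ` Q}"
  have odd_T: "2 * q + 1 \<in> T \<longleftrightarrow> q < n \<and> \<tau> (Suc q) \<in> snd ` Q" for q
    unfolding T_def by (auto; presburger)
  have even_T: "2 * c \<in> T \<longleftrightarrow> 0 < c \<and> c < n \<and> \<tau> c \<in> (\<lambda>b. last (fst b)) ` Q" for c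
    unfolding T_def by (auto; presburger)
  have sub: "T \<subseteq> {1..<2 * n}" unfolding T_def by auto
  have fin: "finite T" using sub finite_subset by blast
  have nonempty: "ys \<noteq> []" if "ys \<in> set bs" for ys
    using that bs(1) PO_blockD(1)[OF Q] by force
  have block: "\<exists>c d q. xs = segment \<tau> c d \<and> p = \<tau> (Suc q) \<and> block_range n T c d \<and> 2 * q + 1 \<in> T \<and> c \<le> q \<and> q < d
      \<and> {s \<in> T. 2 * c < s \<and> s < 2 * d} = {2 * q + 1}"
    if xp: "(xs, p) \<in> Q" for xs p
  proof -
    note xs = PO_blockD[OF Q xp]
    \<comment> \<open>The entry of \<open>bs\<close> containing \<open>p\<close> must be
      \<open>xs\<close>, as blocks are disjoint. So every block of \<open>Q\<close> occurs in the
      word.\<close>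
    have "p \<in> set (concat bs)" using xs(3,4) segment_full_set[OF perm] bs(2) by auto
    then obtain ys where ys: "ys \<in> set bs" "p \<in> set ys" by auto
    then obtain b where b: "b \<in> Q" "ys = fst b" using bs(1) by blast
    have "b = (xs, p)" using PO_block_eq[OF Q b(1) xp, of p] ys b xs(3) by simp
    then have "xs \<in> set bs" using ys b by simp
    then obtain us vs where uv: "bs = us @ xs # vs" by (meson split_list)
    define c where "c = length (concat us)"
    define d where "d = c + length xs"
    have s: "segment \<tau> 0 n = concat us @ xs @ concat vs" using uv bs(2) by simp
    have "length (segment \<tau> 0 n) = length (concat us @ xs @ concat vs)" using s by simp
    then have dn: "d \<le> n" unfolding d_def c_def by (simp add: length_segment)
    have cd: "c < d" using xs(1) by (simp add: d_def)
    have "concat us = take c (segment \<tau> 0 n)" unfolding s c_def by simp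
    then have us: "concat us = segment \<tau> 0 c" using take_segment[of c n \<tau>] cd dn by simp
    have "concat us @ xs = take d (segment \<tau> 0 n)" unfolding s c_def d_def by simp
    then have "segment \<tau> 0 c @ xs = segment \<tau> 0 d" using take_segment[of d n \<tau>] dn us by simp
    then have xseg: "xs = segment \<tau> c d" using segment_append[of 0 c d \<tau>] cd
      by (metis less_imp_le same_append_eq zero_le)
    have cutc: "cut n T c"
    proof (cases "c = 0")
      case False
      have "concat us \<noteq> []" using False unfolding c_def by auto
      then have "us \<noteq> []" by auto
      moreover have "[] \<notin> set us" using nonempty uv by auto
      ultimately have last_us: "\<tau> c = last (last us)" using last_concat[of us] us last_segment[of 0 c \<tau>] False by simp
      have "last us \<in> fst ` Q" using \<open>us \<noteq> []\<close> uv bs(1) by auto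
      then have "\<tau> c \<in> (\<lambda>b. last (fst b)) ` Q" using last_us by force
      then have "2 * c \<in> T" unfolding even_T using False cd dn by auto
      then show ?thesis by (simp add: cut_def)
    qed (simp add: cut_def)
    have lastx: "last xs = \<tau> d" using xseg last_segment[OF cd] by simp
    have cutd: "cut n T d"
    proof (cases "d = n")
      case False
      have "\<tau> d \<in> (\<lambda>b. last (fst b)) ` Q" using lastx xp by force
      then have "2 * d \<in> T" unfolding even_T using False cd dn by auto
      then show ?thesis by (simp add: cut_def)
    qed (simp add: cut_def)
    have inner: "2 * e \<notin> T" if e: "c < e" "e < d" for e
    proof
      assume "2 * e \<in> T"
      then obtain b' where b': "b' \<in> Q" "\<tau> e = last (fst b')" unfolding even_T by auto
      have "\<tau> e \<in> set xs" unfolding xseg set_segment using e by auto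
      moreover have "fst b' \<noteq> []" using PO_blockD(1)[OF Q, of "fst b'" "snd b'"] b'(1) by simp
      then have "\<tau> e \<in> set (fst b')" using b'(2) by simp
      ultimately have "b' = (xs, p)" using PO_block_eq[OF Q b'(1) xp] by simp
      then have "\<tau> e = \<tau> d" using b'(2) lastx by simp
      then show False using inj e by simp
    qed
    obtain i where i: "p = \<tau> i" "c < i" "i \<le> d" using xs(3) unfolding xseg set_segment by auto
    then obtain q where "i = Suc q" by (cases i) auto
    then have q: "p = \<tau> (Suc q)" "c \<le> q" "q < d" using i by auto
    have qT: "2 * q + 1 \<in> T" unfolding odd_T using q dn xp by force
    have only: "s = 2 * q + 1" if sT: "s \<in> T" "2 * c < s" "s < 2 * d" for s
    proof (cases "even s")
      case True
      then obtain e where "s = 2 * e" by (elim evenE)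
      then show ?thesis using inner[of e] sT by simp
    next
      case False
      then obtain r where r: "s = 2 * r + 1" by (elim oddE)
      then obtain b' where b': "b' \<in> Q" "\<tau> (Suc r) = snd b'" using sT(1) odd_T by auto
      have "\<tau> (Suc r) \<in> set xs" unfolding xseg set_segment using sT r by auto
      moreover have "\<tau> (Suc r) \<in> set (fst b')"
        using PO_blockD(3)[OF Q, of "fst b'" "snd b'"] b' by simp
      ultimately have "b' = (xs, p)" using PO_block_eq[OF Q b'(1) xp] by simp
      then show ?thesis using b'(2) q(1) r inj by simp
    qed
    have "2 * c < 2 * q + 1 \<and> 2 * q + 1 < 2 * d" using q by linarith
    then have "{s \<in> T. 2 * c < s \<and> s < 2 * d} = {2 * q + 1}" using only qT by blast
    then show ?thesis using xseg q qT cutc cutd cd inner unfolding block_range_def by blast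
  qed
  have QD: "Q = ppart_of n \<tau> T"
  proof (intro equalityI subsetI)
    fix b assume "b \<in> Q"
    then have "(fst b, snd b) \<in> Q" by simp
    then obtain c d q where h: "fst b = segment \<tau> c d" "snd b = \<tau> (Suc q)" "block_range n T c d" "2 * q + 1 \<in> T"
      "c \<le> q" "q < d" using block by blast
    then have "b = (segment \<tau> c d, \<tau> (Suc q))" by (simp add: prod_eq_iff)
    then show "b \<in> ppart_of n \<tau> T" using h unfolding ppart_of_def by blast
  next
    fix b assume "b \<in> ppart_of n \<tau> T"
    then obtain c d q where h: "b = (segment \<tau> c d, \<tau> (Suc q))" "block_range n T c d" "2 * q + 1 \<in> T" "c \<le> q" "q < d"
      unfolding ppart_of_def by blast
    then obtain xs where xp: "(xs, \<tau> (Suc q)) \<in> Q" unfolding odd_T by force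
    obtain c' d' q' where h': "xs = segment \<tau> c' d'" "\<tau> (Suc q) = \<tau> (Suc q')" "block_range n T c' d'" "c' \<le> q'" "q' < d'"
      using block[OF xp] by blast
    have "q' = q" using inj[of "Suc q" "Suc q'"] h'(2) by blast
    then have "c' < Suc q" "Suc q \<le> d'" "c < Suc q" "Suc q \<le> d" using h(4,5) h'(4,5) by linarith+
    then have "c = c' \<and> d = d'" using block_range_unique[OF sub h(2) h'(3)] by blast
    then show "b \<in> Q" using xp unfolding h(1) h'(1) by blast
  qed
  have find: "\<exists>c d q. block_range n T c d \<and> c < i \<and> i \<le> d \<and> 2 * q + 1 \<in> T \<and> c \<le> q \<and> q < d
      \<and> {s \<in> T. 2 * c < s \<and> s < 2 * d} = {2 * q + 1}" if i: "0 < i" "i \<le> n" for i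
  proof -
    have "\<tau> i \<in> {1..n}" using permutes_in_image[OF perm, of i] i by simp
    then obtain xs p where xp: "(xs, p) \<in> Q" "\<tau> i \<in> set xs" using PO_cover[OF Q] by blast
    obtain c d q where h: "xs = segment \<tau> c d" "block_range n T c d" "2 * q + 1 \<in> T" "c \<le> q" "q < d"
       "{s \<in> T. 2 * c < s \<and> s < 2 * d} = {2 * q + 1}" using block[OF xp(1)] by blast
    moreover have "c < i" "i \<le> d" using xp(2) unfolding h(1) set_segment by (auto simp: inj)
    ultimately show ?thesis by blast
  qed
  \<comment> \<open>Every block up to a cut brings one point and the cut ending it.\<close>
  have ev: "even (card {s \<in> T. s \<le> 2 * c})" if "cut n T c" "c < n" for c
    using that
  proof (induction c rule: less_induct)
    case (less d)
    show ?case
    proof (cases "d = 0")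
      case True
      then have e: "{s \<in> T. s \<le> 2 * d} = {}" using sub by auto
      show ?thesis unfolding e by simp
    next
      case False
      obtain c e q where h: "block_range n T c e" "c < d" "d \<le> e" "c \<le> q" "q < e" "2 * q + 1 \<in> T"
        "{s \<in> T. 2 * c < s \<and> s < 2 * e} = {2 * q + 1}"
        using find[of d] False less.prems by auto
      have "\<not> (c < d \<and> d < e)" by (rule cut_inner[OF sub h(1) less.prems(1)])
      then have e: "e = d" using h by linarith
      have dT: "2 * d \<in> T" using less.prems False by (auto simp: cut_def)
      have "s \<le> 2 * c \<or> s = 2 * q + 1 \<or> s = 2 * d" if sT: "s \<in> T" "s \<le> 2 * d" for s
      proof (rule ccontr)
        assume n: "\<not> ?thesis"
        then have "2 * c < s" "s < 2 * e" using sT e by linarith+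
        then have "s \<in> {2 * q + 1}" using sT(1) unfolding h(7)[symmetric] by blast
        then show False using n by blast
      qed
      moreover have "2 * q + 1 \<le> 2 * d" "\<And>s. s \<le> 2 * c \<Longrightarrow> s \<le> 2 * d" using h(2,5) e by linarith+
      ultimately have "{s \<in> T. s \<le> 2 * d} = insert (2 * d) (insert (2 * q + 1) {s \<in> T. s \<le> 2 * c})"
        using h(6) dT by blast
      moreover have "2 * d \<noteq> 2 * q + 1" by presburger
      ultimately have "card {s \<in> T. s \<le> 2 * d} = Suc (Suc (card {s \<in> T. s \<le> 2 * c}))"
        using fin h(2,4) by simp
      moreover have "even (card {s \<in> T. s \<le> 2 * c})"
        using less.IH[of c] h less.prems by (simp add: block_range_def)
      ultimately show ?thesis by simp
    qed
  qed
  \<comment> \<open>The last block brings a point but no cut.\<close>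
  have "odd (card T)"
  proof -
    obtain c e q where h: "block_range n T c e" "c < n" "n \<le> e" "c \<le> q" "q < e" "2 * q + 1 \<in> T"
        "{s \<in> T. 2 * c < s \<and> s < 2 * e} = {2 * q + 1}"
      using find[of n] n by auto
    have "e \<le> n" using cut_le[OF sub] h(1) by (auto simp: block_range_def)
    have "s \<le> 2 * c \<or> s = 2 * q + 1" if sT: "s \<in> T" for s
    proof (rule ccontr)
      assume n: "\<not> ?thesis"
      moreover have "s < 2 * n" using sub sT by auto
      ultimately have "2 * c < s" "s < 2 * e" using h(3) by linarith+
      then have "s \<in> {2 * q + 1}" using sT unfolding h(7)[symmetric] by blast
      then show False using n by blast
    qed
    then have "T = insert (2 * q + 1) {s \<in> T. s \<le> 2 * c}" using h(6) by blast
    moreover have "card (insert (2 * q + 1) {s \<in> T. s \<le> 2 * c}) = Suc (card {s \<in> T. s \<le> 2 * c})"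
      using fin h(4) by simp
    ultimately have "card T = Suc (card {s \<in> T. s \<le> 2 * c})" by metis
    moreover have "even (card {s \<in> T. s \<le> 2 * c})" using ev h by (simp add: block_range_def)
    ultimately show ?thesis by simp
  qed
  \<comment> \<open>An odd element is alone inside its block, so its rank is one more than the even
    count up to the left end of the block.\<close>
  moreover have "even (card {s \<in> T. s \<le> t} + t)" if t: "t \<in> T" for t
  proof (cases "even t")
    case True
    then obtain c where c: "t = 2 * c" by (elim evenE)
    then show ?thesis using ev[of c] t even_T[of c] by (simp add: cut_def)
  next
    case False
    then obtain r where r: "t = 2 * r + 1" by (elim oddE)
    then have "r < n" using t odd_T by simp
    then obtain c e q where h: "block_range n T c e" "c < Suc r" "Suc r \<le> e"
        "{s \<in> T. 2 * c < s \<and> s < 2 * e} = {2 * q + 1}"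
      using find[of "Suc r"] by auto
    have "2 * c < t \<and> t < 2 * e" using r h(2,3) by linarith
    then have "t \<in> {2 * q + 1}" using t unfolding h(4)[symmetric] by blast
    then have tq: "{s \<in> T. 2 * c < s \<and> s < 2 * e} = {t}" using h(4) by blast
    have "s \<le> 2 * c \<or> s = t" if sT: "s \<in> T" "s \<le> t" for s
    proof (rule ccontr)
      assume n: "\<not> ?thesis"
      then have "2 * c < s" "s < 2 * e" using sT(2) h(3) r by linarith+
      then have "s \<in> {t}" using sT(1) unfolding tq[symmetric] by blast
      then show False using n by blast
    qed
    moreover have "\<And>s. s \<le> 2 * c \<Longrightarrow> s \<le> t" using h(2) r by linarith
    ultimately have "{s \<in> T. s \<le> t} = insert t {s \<in> T. s \<le> 2 * c}" using t by blast
    then have "card {s \<in> T. s \<le> t} = Suc (card {s \<in> T. s \<le> 2 * c})" using fin h(2) r by simp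
    moreover have "e \<le> n" using cut_le[OF sub] h(1) by (auto simp: block_range_def)
    then have "even (card {s \<in> T. s \<le> 2 * c})" using ev[of c] h by (simp add: block_range_def)
    ultimately show ?thesis using False by simp
  qed
  ultimately show ?thesis using QD sub unfolding alternating_def by blast
qed

text \<open>Refinement preserves the word: this carries the word of the minimal element up a
  chain.\<close>

lemma concat_refine:
  assumes "po_le P Q" "set bs \<subseteq> fst ` P"
  shows "\<exists>bs'. set bs' \<subseteq> fst ` Q \<and> concat bs' = concat bs"
  using assms(2)
proof (induction bs)
  case Nil
  then show ?case by (intro exI[of _ "[]"]) simp
next
  case (Cons xs bs)
  then obtain bs' where bs': "set bs' \<subseteq> fst ` Q" "concat bs' = concat bs" by auto
  obtain p where "(xs, p) \<in> P" using Cons.prems by auto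
  then obtain cs where cs: "set cs \<subseteq> fst ` Q" "concat cs = xs" using assms(1) unfolding po_le_def by blast
  show ?case using bs' cs by (intro exI[of _ "cs @ bs'"]) simp
qed

section \<open>Minimal and maximal elements\<close>

lemma ppart_of_singleton:
  assumes "p < n"
  shows "ppart_of n \<tau> {2 * p + 1} = {(segment \<tau> 0 n, \<tau> (Suc p))}"
proof -
  have "2 * c \<noteq> 2 * p + 1" for c by presburger
  then have "block_range n {2 * p + 1} c d \<longleftrightarrow> c = 0 \<and> d = n" for c d
    using assms by (auto simp: block_range_def cut_def)
  then show ?thesis using assms by (auto simp: ppart_of_def)
qed

lemma permutes_of_list:
  assumes "distinct xs" "set xs = {1..n}"
  shows "\<exists>\<tau>. \<tau> permutes {1..n} \<and> xs = segment \<tau> 0 n"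
proof -
  have len: "length xs = n" using distinct_card[OF assms(1)] assms(2) by simp
  define \<tau> where "\<tau> i = (if i \<in> {1..n} then xs ! (i - 1) else i)" for i
  have "bij_betw (\<lambda>i. i - 1) {1..n} {..<n}"
    by (rule bij_betw_byWitness[where f' = Suc]) auto
  moreover have "bij_betw ((!) xs) {..<n} {1..n}"
    using bij_betw_nth[OF assms(1), of "{..<n}" "{1..n}"] len assms(2) by simp
  ultimately have "bij_betw ((!) xs \<circ> (\<lambda>i. i - 1)) {1..n} {1..n}" by (rule bij_betw_trans)
  then have "bij_betw \<tau> {1..n} {1..n}"
    by (rule bij_betw_cong[THEN iffD1, rotated]) (simp add: \<tau>_def)
  then have "\<tau> permutes {1..n}" by (rule bij_imp_permutes) (simp add: \<tau>_def del: atLeastAtMost_iff)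
  moreover have "xs = segment \<tau> 0 n"
    by (rule nth_equalityI) (simp_all add: len length_segment segment_def \<tau>_def del: upt_Suc)
  ultimately show ?thesis by blast
qed

text \<open>Concatenate the blocks in any order and keep any one of the points. The choice of order
  is why a partition may lie above several words.\<close>

lemma single_block_below:
  assumes "n \<ge> 1" "P \<in> PO n"
  shows "\<exists>\<tau> p. \<tau> permutes {1..n} \<and> p < n \<and> po_le (ppart_of n \<tau> {2 * p + 1}) P"
proof -
  note P = assms(2)
  have "finite P" using P by (simp add: PO_def is_ppart_def)
  then obtain L where L: "set L = P" "distinct L" using finite_distinct_list by blast
  obtain ys p where yp: "(ys, p) \<in> P" using PO_cover[OF P, of 1] assms(1) by auto
  define w where "w = concat (map fst L)"
  have "distinct (concat (map fst L'))" if "set L' \<subseteq> P" "distinct L'" for L'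
    using that
  proof (induction L')
    case (Cons b L')
    have "distinct (fst b)" using PO_blockD(2)[OF P, of "fst b" "snd b"] Cons.prems by simp
    moreover have "set (fst b) \<inter> set (fst b') = {}" if "b' \<in> set L'" for b'
      using PO_block_eq[OF P, of b b'] that Cons.prems by auto
    ultimately show ?case using Cons by auto
  qed simp
  then have "distinct w" using L by (simp add: w_def)
  moreover have "set w = {1..n}" using P L(1) by (auto simp: w_def PO_def is_ppart_def)
  ultimately obtain \<tau> where \<tau>: "\<tau> permutes {1..n}" "w = segment \<tau> 0 n" using permutes_of_list by blast
  have "p \<in> {1..n}" using PO_blockD(3,4)[OF P yp] by blast
  then have "p \<in> set (segment \<tau> 0 n)" using \<tau> segment_full_set by blast
  then obtain i where i: "0 < i" "i \<le> n" "p = \<tau> i" by (auto simp: set_segment)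
  then obtain q where q: "i = Suc q" by (cases i) auto
  have "po_le (ppart_of n \<tau> {2 * q + 1}) P"
  proof -
    have "ppart_of n \<tau> {2 * q + 1} = {(concat (map fst L), p)}"
      using ppart_of_singleton[of q n \<tau>] i q \<tau>(2) by (simp add: w_def)
    moreover have "p \<in> snd ` P" using yp by force
    ultimately show ?thesis using L(1) unfolding po_le_def by (auto intro!: exI[of _ "map fst L"])
  qed
  then show ?thesis using \<tau>(1) i q by (intro exI[of _ \<tau>] exI[of _ q]) auto
qed

text \<open>A block of \<open>Q\<close> is a concatenation of copies of \<open>w\<close>, and two
  copies would repeat letters.\<close>

lemma below_single_block:
  assumes "n \<ge> 1" "Q \<in> PO n" "w \<noteq> []" "po_le Q {(w, p)}"
  shows "Q = {(w, p)}"
proof -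
  have "(xs, r) = (w, p)" if xr: "(xs, r) \<in> Q" for xs r
  proof -
    note xs = PO_blockD[OF assms(2) xr]
    have "r = p" using assms(4) xr by (force simp: po_le_def)
    obtain bs where bs: "set bs \<subseteq> {w}" "concat bs = xs" using assms(4) xr unfolding po_le_def by force
    have "bs \<noteq> []" using bs(2) xs(1) by auto
    then obtain b bs' where b: "bs = b # bs'" by (cases bs) auto
    have "bs' = []"
    proof (cases bs')
      case (Cons b' bs'')
      then have "xs = w @ w @ concat bs''" using bs b by auto
      then have "distinct (w @ w)" using xs(2) by simp
      then show ?thesis using assms(3) by simp
    qed
    then show ?thesis using bs b \<open>r = p\<close> by simp
  qed
  moreover have "Q \<noteq> {}" using PO_cover[OF assms(2), of 1] assms(1) by auto
  ultimately show ?thesis by auto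
qed

lemma po_minimal_iff:
  assumes "n \<ge> 1"
  shows "po_minimal n P \<longleftrightarrow> (\<exists>\<tau> p. \<tau> permutes {1..n} \<and> p < n \<and> P = ppart_of n \<tau> {2 * p + 1})"
proof
  assume min: "po_minimal n P"
  then have "P \<in> PO n" by (simp add: po_minimal_def)
  then obtain \<tau> p where \<tau>: "\<tau> permutes {1..n}" "p < n" "po_le (ppart_of n \<tau> {2 * p + 1}) P"
    using single_block_below[OF assms] by blast
  moreover have "ppart_of n \<tau> {2 * p + 1} \<in> PO n" by (rule ppart_of_PO[OF \<tau>(1) alternating_singleton[OF \<tau>(2)]])
  ultimately show "\<exists>\<tau> p. \<tau> permutes {1..n} \<and> p < n \<and> P = ppart_of n \<tau> {2 * p + 1}"
    using min unfolding po_minimal_def po_less_def by metis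
next
  assume "\<exists>\<tau> p. \<tau> permutes {1..n} \<and> p < n \<and> P = ppart_of n \<tau> {2 * p + 1}"
  then obtain \<tau> p where \<tau>: "\<tau> permutes {1..n}" "p < n" "P = ppart_of n \<tau> {2 * p + 1}" by blast
  have P: "P \<in> PO n" unfolding \<tau>(3) by (rule ppart_of_PO[OF \<tau>(1) alternating_singleton[OF \<tau>(2)]])
  have "segment \<tau> 0 n \<noteq> []" using length_segment[of \<tau> 0 n] assms by auto
  then have "Q = P" if "Q \<in> PO n" "po_le Q P" for Q
    using below_single_block[OF assms that(1)] that(2) unfolding \<tau>(3) ppart_of_singleton[OF \<tau>(2)] by blast
  then show "po_minimal n P" using P unfolding po_minimal_def po_less_def by blast
qed

definition singletons :: "nat \<Rightarrow> ppart" where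
  "singletons n = (\<lambda>i. ([i], i)) ` {1..n}"

lemma po_le_singletons: "P \<in> PO n \<Longrightarrow> po_le P (singletons n)"
proof -
  assume P: "P \<in> PO n"
  have "snd b \<in> {1..n}" if "b \<in> P" for b
    using PO_blockD(3,4)[OF P, of "fst b" "snd b"] that by auto
  then have "snd ` P \<subseteq> snd ` singletons n" by (auto simp: singletons_def image_image)
  moreover have "\<exists>bs. set bs \<subseteq> fst ` singletons n \<and> concat bs = xs" if "(xs, p) \<in> P" for xs p
    using PO_blockD(4)[OF P that]
    by (intro exI[of _ "map (\<lambda>i. [i]) xs"]) (auto simp: singletons_def image_image)
  ultimately show ?thesis unfolding po_le_def by blast
qed

lemma singletons_PO: "singletons n \<in> PO n"
  by (auto simp: PO_def is_ppart_def singletons_def)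

text \<open>Above the partition into pointed letters every letter must stay pointed; a block has one
  point only, so it has one letter only.\<close>

lemma po_maximal_iff: "po_maximal n P \<longleftrightarrow> P = singletons n"
proof
  show "po_maximal n P \<Longrightarrow> P = singletons n"
    using po_le_singletons[of P n] singletons_PO[of n] unfolding po_maximal_def po_less_def by blast
  have "Q = singletons n" if Q: "Q \<in> PO n" and le: "po_le (singletons n) Q" for Q
  proof -
    have point: "\<exists>ys. (ys, i) \<in> Q" if "i \<in> {1..n}" for i
    proof -
      have "i \<in> snd ` singletons n" using that by (auto simp: singletons_def image_image)
      then have "i \<in> snd ` Q" using le by (auto simp: po_le_def)
      then show ?thesis by force
    qed
    have single: "xs = [p]" if xp: "(xs, p) \<in> Q" for xs p
    proof -
      note xs = PO_blockD[OF Q xp]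
      have "i = p" if i: "i \<in> set xs" for i
      proof -
        obtain ys where ys: "(ys, i) \<in> Q" using point xs(4) i by blast
        then have "i \<in> set ys" using PO_blockD(3)[OF Q] by blast
        then show ?thesis using PO_block_eq[OF Q ys xp, of i] i by simp
      qed
      then have "set xs = {p}" using xs(3) by blast
      then have "length xs = 1" using distinct_card[OF xs(2)] by simp
      then show ?thesis using \<open>set xs = {p}\<close> by (cases xs) auto
    qed
    have "b \<in> singletons n" if "b \<in> Q" for b
      using single[of "fst b" "snd b"] PO_blockD(3,4)[OF Q, of "fst b" "snd b"] that
      by (cases b) (auto simp: singletons_def)
    moreover have "([i], i) \<in> Q" if "i \<in> {1..n}" for i using point[OF that] single by blast
    ultimately show ?thesis by (auto simp: singletons_def)
  qed
  then show "P = singletons n \<Longrightarrow> po_maximal n P"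
    using singletons_PO[of n] unfolding po_maximal_def po_less_def by blast
qed

lemma ppart_of_full:
  assumes "n \<ge> 1" "\<tau> permutes {1..n}"
  shows "ppart_of n \<tau> (full n) = singletons n"
proof -
  have P: "ppart_of n \<tau> (full n) \<in> PO n" by (rule ppart_of_PO[OF assms(2) alternating_full[OF assms(1)]])
  have single: "xs = [p]" if xp: "(xs, p) \<in> ppart_of n \<tau> (full n)" for xs p
  proof -
    obtain c d q where h: "xs = segment \<tau> c d" "p = \<tau> (Suc q)" "block_range n (full n) c d" "c \<le> q" "q < d"
      using xp unfolding ppart_of_def by blast
    have "d \<le> n" using cut_le[of "full n" n d] h(3) by (simp add: block_range_def full_def)
    have d: "d = Suc c"
    proof (rule ccontr)
      assume "d \<noteq> Suc c"
      then have "c < Suc c" "Suc c < d" using h by auto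
      then have "2 * Suc c \<notin> full n" using h(3) unfolding block_range_def by blast
      then show False using \<open>d \<le> n\<close> \<open>Suc c < d\<close> by (simp add: full_def)
    qed
    have "q = c" using h(4,5) d by linarith
    then show ?thesis unfolding h(1,2) d by (simp add: segment_def)
  qed
  have "b \<in> singletons n" if "b \<in> ppart_of n \<tau> (full n)" for b
    using single[of "fst b" "snd b"] PO_blockD(3,4)[OF P, of "fst b" "snd b"] that
    by (cases b) (auto simp: singletons_def)
  moreover have "([i], i) \<in> ppart_of n \<tau> (full n)" if i: "i \<in> {1..n}" for i
  proof -
    obtain xs p where xp: "(xs, p) \<in> ppart_of n \<tau> (full n)" "i \<in> set xs" using PO_cover[OF P i] by blast
    then have "xs = [i]" "p = i" using single[OF xp(1)] by simp_all
    then show ?thesis using xp by simp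
  qed
  ultimately show ?thesis by (auto simp: singletons_def)
qed

section \<open>Chains of the poset as words with chains of alternating sets\<close>

lemma alternating_chain_nth_iff:
  "alternating_chain n u \<longleftrightarrow> u \<noteq> [] \<and> (\<forall>x\<in>set u. alternating n x) \<and> (\<forall>i<length u - 1. u ! i \<subset> u ! Suc i) \<and> last u = full n"
proof (induction n u rule: alternating_chain.induct)
  case (3 n x y zs)
  have "(\<forall>i<length (x # y # zs) - 1. (x # y # zs) ! i \<subset> (x # y # zs) ! Suc i) \<longleftrightarrow>
    x \<subset> y \<and> (\<forall>i<length (y # zs) - 1. (y # zs) ! i \<subset> (y # zs) ! Suc i)"
    using All_less_Suc2[of "length zs" "\<lambda>i. (x # y # zs) ! i \<subset> (x # y # zs) ! Suc i"] by simp
  then show ?case using 3 by auto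
qed auto

lemma perm_eq_of_segment:
  assumes "\<tau> permutes {1..n}" "\<tau>' permutes {1..n}" "segment \<tau> 0 n = segment \<tau>' 0 n"
  shows "\<tau> = \<tau>'"
proof
  fix i
  show "\<tau> i = \<tau>' i"
  proof (cases "i \<in> {1..n}")
    case True
    then have "i \<in> set [Suc 0..<Suc n]" by auto
    then show ?thesis using assms(3) unfolding segment_def map_eq_conv by blast
  next
    case False
    then show ?thesis using assms(1,2) permutes_not_in by metis
  qed
qed

lemma ppart_chain_in_chains:
  assumes "n \<ge> 1" "\<tau> permutes {1..n}" "u \<in> alternating_chains n l"
  shows "map (ppart_of n \<tau>) u \<in> chains n l"
proof -
  have u: "length u = Suc l" "u \<noteq> []" "\<And>x. x \<in> set u \<Longrightarrow> alternating n x" "last u = full n" "card (hd u) = 1"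
    "\<And>i. i < l \<Longrightarrow> u ! i \<subset> u ! Suc i"
    using assms(3) by (auto simp: alternating_chains_def alternating_chain_nth_iff)
  have "po_less (map (ppart_of n \<tau>) u ! i) (map (ppart_of n \<tau>) u ! Suc i)" if i: "i < l" for i
  proof -
    have a: "alternating n (u ! i)" "alternating n (u ! Suc i)" using u(1,3) i by auto
    have "po_le (ppart_of n \<tau> (u ! i)) (ppart_of n \<tau> (u ! Suc i))"
      by (rule po_le_ppart_of[OF a]) (use u(6)[OF i] in blast)
    moreover have "ppart_of n \<tau> (u ! i) \<noteq> ppart_of n \<tau> (u ! Suc i)"
      using ppart_of_inj[OF assms(2) a] u(6)[OF i] by blast
    ultimately show ?thesis using u(1) i by (simp add: po_less_def)
  qed
  moreover have "po_minimal n (ppart_of n \<tau> (hd u))"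
  proof -
    have "alternating n (hd u)" using u(2,3) by simp
    then obtain p where "p < n" "hd u = {2 * p + 1}" using u(5) by (rule alternating_card_1)
    then show ?thesis unfolding po_minimal_iff[OF assms(1)] using assms(2) by (intro exI[of _ \<tau>] exI[of _ p]) simp
  qed
  moreover have "po_maximal n (ppart_of n \<tau> (last u))"
    using ppart_of_full[OF assms(1,2)] u(4) po_maximal_iff by simp
  moreover have "ppart_of n \<tau> ` set u \<subseteq> PO n" using u(3) ppart_of_PO[OF assms(2)] by blast
  ultimately show ?thesis using u(1,2) by (simp add: chains_def hd_map last_map)
qed

text \<open>The word of the minimal element is spelled by the blocks of each member, so
  \<open>ppart_of_exists\<close> applies with the same permutation throughout.\<close>

lemma chains_ppart_chain:
  assumes "n \<ge> 1" "cs \<in> chains n l"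
  shows "\<exists>\<tau> u. \<tau> permutes {1..n} \<and> u \<in> alternating_chains n l \<and> cs = map (ppart_of n \<tau>) u"
proof -
  have cs: "length cs = Suc l" "set cs \<subseteq> PO n" "\<And>i. i < l \<Longrightarrow> po_less (cs ! i) (cs ! Suc i)"
    "po_minimal n (hd cs)" "po_maximal n (last cs)"
    using assms(2) by (auto simp: chains_def)
  have ne: "cs \<noteq> []" using cs(1) by auto
  obtain \<tau> p where \<tau>: "\<tau> permutes {1..n}" "p < n" "hd cs = ppart_of n \<tau> {2 * p + 1}"
    using cs(4) po_minimal_iff[OF assms(1)] by blast
  have word: "\<exists>bs. set bs \<subseteq> fst ` (cs ! i) \<and> concat bs = segment \<tau> 0 n" if "i \<le> l" for i
    using that
  proof (induction i)
    case 0
    have "cs ! 0 = {(segment \<tau> 0 n, \<tau> (Suc p))}"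
      using \<tau>(3) ne ppart_of_singleton[OF \<tau>(2)] by (simp add: hd_conv_nth)
    then show ?case by (intro exI[of _ "[segment \<tau> 0 n]"]) simp
  next
    case (Suc i)
    then obtain bs where "set bs \<subseteq> fst ` (cs ! i)" "concat bs = segment \<tau> 0 n" by auto
    moreover have "po_le (cs ! i) (cs ! Suc i)" using cs(3)[of i] Suc.prems by (simp add: po_less_def)
    ultimately show ?case using concat_refine by metis
  qed
  have "\<exists>T. alternating n T \<and> c = ppart_of n \<tau> T" if c: "c \<in> set cs" for c
  proof -
    obtain i where i: "i < length cs" "c = cs ! i" using c by (metis in_set_conv_nth)
    then obtain bs where "set bs \<subseteq> fst ` c" "concat bs = segment \<tau> 0 n" using word[of i] cs(1) by auto
    then show ?thesis using ppart_of_exists[OF assms(1) \<tau>(1)] c cs(2) by blast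
  qed
  then obtain T where T: "\<And>c. c \<in> set cs \<Longrightarrow> alternating n (T c) \<and> c = ppart_of n \<tau> (T c)" by metis
  define u where "u = map T cs"
  have csu: "cs = map (ppart_of n \<tau>) u"
    unfolding u_def map_map by (rule map_idI[symmetric]) (use T in auto)
  have hdu: "hd u = {2 * p + 1}"
  proof (rule ppart_of_inj[OF \<tau>(1) _ alternating_singleton[OF \<tau>(2)]])
    have "hd cs \<in> set cs" using ne by simp
    then show "alternating n (hd u)" "ppart_of n \<tau> (hd u) = ppart_of n \<tau> {2 * p + 1}"
      using T[of "hd cs"] \<tau>(3) ne unfolding u_def by (auto simp: hd_map)
  qed
  have lastu: "last u = full n"
  proof (rule ppart_of_inj[OF \<tau>(1) _ alternating_full[OF assms(1)]])
    have "last cs \<in> set cs" using ne by simp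
    moreover have "last cs = singletons n" using cs(5) po_maximal_iff by blast
    ultimately show "alternating n (last u)" "ppart_of n \<tau> (last u) = ppart_of n \<tau> (full n)"
      using T[of "last cs"] ne unfolding u_def ppart_of_full[OF assms(1) \<tau>(1)] by (auto simp: last_map)
  qed
  have alts: "\<forall>x\<in>set u. alternating n x" using T unfolding u_def by auto
  have "u ! i \<subset> u ! Suc i" if i: "i < l" for i
  proof -
    have lu: "length u = Suc l" using cs(1) by (simp add: u_def)
    have a: "alternating n (u ! i)" "alternating n (u ! Suc i)" using alts lu i by auto
    have "po_less (ppart_of n \<tau> (u ! i)) (ppart_of n \<tau> (u ! Suc i))"
      using cs(3)[OF i] lu i unfolding csu by simp
    then show ?thesis using po_le_ppart_ofD[OF \<tau>(1) a] unfolding po_less_def by auto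
  qed
  then have "u \<in> alternating_chains n l" using cs(1) hdu lastu alts ne unfolding alternating_chains_def alternating_chain_nth_iff by (simp add: u_def)
  then show ?thesis using \<tau>(1) csu by blast
qed

text \<open>The least members are single blocks and display the whole word; once the words agree,
  \<open>ppart_of_inj\<close> compares the sets.\<close>

lemma ppart_chain_inj:
  assumes "n \<ge> 1" "\<tau> permutes {1..n}" "\<tau>' permutes {1..n}" "u \<in> alternating_chains n l" "u' \<in> alternating_chains n l'"
    "map (ppart_of n \<tau>) u = map (ppart_of n \<tau>') u'"
  shows "\<tau> = \<tau>' \<and> u = u'"
proof -
  have u: "u \<noteq> []" "\<forall>x\<in>set u. alternating n x" "card (hd u) = 1" using assms(4) by (auto simp: alternating_chains_def alternating_chain_nth_iff)
  have u': "u' \<noteq> []" "\<forall>x\<in>set u'. alternating n x" "card (hd u') = 1" using assms(5) by (auto simp: alternating_chains_def alternating_chain_nth_iff)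
  obtain p where p: "p < n" "hd u = {2 * p + 1}" using alternating_card_1[of n "hd u"] u by auto
  obtain p' where p': "p' < n" "hd u' = {2 * p' + 1}" using alternating_card_1[of n "hd u'"] u' by auto
  have "ppart_of n \<tau> (hd u) = ppart_of n \<tau>' (hd u')" using assms(6) u(1) u'(1) by (metis hd_map)
  then have "segment \<tau> 0 n = segment \<tau>' 0 n"
    unfolding p p' ppart_of_singleton[OF p(1)] ppart_of_singleton[OF p'(1)] by simp
  then have \<tau>: "\<tau> = \<tau>'" by (rule perm_eq_of_segment[OF assms(2,3)])
  have "inj_on (ppart_of n \<tau>) (set u \<union> set u')"
    using ppart_of_inj[OF assms(2)] u(2) u'(2) by (intro inj_onI) blast
  then have "u = u'" using assms(6) unfolding \<tau>[symmetric] by (rule inj_on_map_eq_map[THEN iffD1])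
  then show ?thesis using \<tau> by simp
qed

text \<open>The sets code positions in the word, and relabelling changes only the letters
  there.\<close>

lemma perm_chain_ppart_chain:
  "perm_chain \<sigma> (map (ppart_of n \<tau>) u) = map (ppart_of n (\<sigma> \<circ> \<tau>)) u"
proof -
  have block: "(map \<sigma> (segment \<tau> c d), \<sigma> (\<tau> (Suc q))) = (segment (\<sigma> \<circ> \<tau>) c d, (\<sigma> \<circ> \<tau>) (Suc q))" for c d q
    by (simp add: segment_def)
  have "perm_ppart \<sigma> (ppart_of n \<tau> T) = ppart_of n (\<sigma> \<circ> \<tau>) T" for T
  proof -
    have "perm_ppart \<sigma> (ppart_of n \<tau> T) = {(map \<sigma> (segment \<tau> c d), \<sigma> (\<tau> (Suc q))) | c d q.
        block_range n T c d \<and> 2 * q + 1 \<in> T \<and> c \<le> q \<and> q < d}"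
      unfolding perm_ppart_def ppart_of_def by force
    then show ?thesis unfolding block ppart_of_def .
  qed
  then show ?thesis by (simp add: perm_chain_def)
qed

section \<open>Homology of the pointed ordered partition poset\<close>

abbreviation ppart_chain :: "nat \<Rightarrow> (nat \<Rightarrow> nat) \<Rightarrow> nat set list \<Rightarrow> ppart list" where
  "ppart_chain n \<tau> u \<equiv> map (ppart_of n \<tau>) u"

lemma chains_bij:
  assumes "n \<ge> 1"
  shows "bij_betw (\<lambda>(\<tau>, u). ppart_chain n \<tau> u) ({\<tau>. \<tau> permutes {1..n}} \<times> alternating_chains n l) (chains n l)"
  unfolding bij_betw_def
proof
  show "inj_on (\<lambda>(\<tau>, u). ppart_chain n \<tau> u) ({\<tau>. \<tau> permutes {1..n}} \<times> alternating_chains n l)"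
    using ppart_chain_inj[OF assms] by (intro inj_onI) auto
  show "(\<lambda>(\<tau>, u). ppart_chain n \<tau> u) ` ({\<tau>. \<tau> permutes {1..n}} \<times> alternating_chains n l) = chains n l"
    using ppart_chain_in_chains[OF assms] chains_ppart_chain[OF assms, of _ l] by (auto simp: image_iff) metis
qed

lemma bdry_eq_boundary: "bdry n l c = boundary (chains n l) c"
proof
  fix cs'
  show "bdry n l c cs' = boundary (chains n l) c cs'"
    unfolding bdry_def boundary_def
  proof (rule sum.cong[OF refl])
    fix cs assume "cs \<in> chains n l"
    then have "length cs - 1 = l" by (simp add: chains_def)
    then show "(\<Sum>i\<in>{1..<l}. if del_at i cs = cs' then (-1) ^ i * c cs else 0) = incidence cs cs' * c cs"
      unfolding incidence_def sum_distrib_right by (auto intro!: sum.cong)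
  qed
qed

section \<open>Splitting of the complex along words\<close>

text \<open>A face keeps the minimal element and hence the word, so the incidence between chains of
  different words is zero.\<close>

lemma boundary_ppart_chain:
  fixes c :: "ppart list \<Rightarrow> 'k::comm_ring_1"
  assumes n: "n \<ge> 1" and \<tau>: "\<tau> permutes {1..n}" and w: "w \<in> alternating_chains n (l - 1)"
  shows "boundary (chains n l) c (ppart_chain n \<tau> w) = boundary (alternating_chains n l) (\<lambda>u. c (ppart_chain n \<tau> u)) w"
proof -
  let ?P = "{\<tau>. \<tau> permutes {1..n}}"
  have incidence: "incidence (ppart_chain n \<sigma> u) (ppart_chain n \<tau> w) = (if \<sigma> = \<tau> then incidence u w else (0::'k))"
    if \<sigma>: "\<sigma> permutes {1..n}" and u: "u \<in> alternating_chains n l" for \<sigma> u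
  proof -
    have len: "length u - 1 = l" using u by (simp add: alternating_chains_def)
    have "del_at i (ppart_chain n \<sigma> u) = ppart_chain n \<tau> w \<longleftrightarrow> \<sigma> = \<tau> \<and> del_at i u = w"
      if i: "i \<in> {1..<l}" for i
      using ppart_chain_inj[OF n \<sigma> \<tau> alternating_chains_del_at[OF u i] w] by (auto simp: map_del_at[symmetric])
    then show ?thesis unfolding incidence_def len length_map by (auto intro!: sum.cong sum.neutral)
  qed
  have "boundary (chains n l) c (ppart_chain n \<tau> w)
      = (\<Sum>(\<sigma>, u)\<in>?P \<times> alternating_chains n l. incidence (ppart_chain n \<sigma> u) (ppart_chain n \<tau> w) * c (ppart_chain n \<sigma> u))"
    unfolding boundary_def using sum.reindex_bij_betw[OF chains_bij[OF n, of l], symmetric]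
    by (simp add: case_prod_beta)
  also have "\<dots> = (\<Sum>\<sigma>\<in>?P. if \<sigma> = \<tau> then boundary (alternating_chains n l) (\<lambda>u. c (ppart_chain n \<sigma> u)) w else 0)"
    unfolding sum.cartesian_product[symmetric] boundary_def
    by (rule sum.cong) (auto simp: incidence intro!: sum.cong sum.neutral)
  also have "\<dots> = boundary (alternating_chains n l) (\<lambda>u. c (ppart_chain n \<tau> u)) w"
    using \<tau> finite_permutations[of "{1..n}"] by simp
  finally show ?thesis .
qed

lemma boundary_chains_supp:
  assumes n: "n \<ge> 1"
  shows "supp_on (chains n (l - 1)) (boundary (chains n l) c)"
  unfolding supp_on_def
proof (intro allI impI)
  fix cs' assume nz: "boundary (chains n l) c cs' \<noteq> 0"
  obtain cs where cs: "cs \<in> chains n l" "incidence cs cs' * c cs \<noteq> 0"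
    using nz unfolding boundary_def by (rule sum.not_neutral_contains_not_neutral)
  then have "(incidence cs cs' :: 'a) \<noteq> 0" by auto
  then obtain i where i: "i \<in> {1..<length cs - 1}" "del_at i cs = cs'" by (rule incidence_nonzeroE)
  obtain \<tau> u where u: "\<tau> permutes {1..n}" "u \<in> alternating_chains n l" "cs = ppart_chain n \<tau> u"
    using chains_ppart_chain[OF n cs(1)] by blast
  have "i \<in> {1..<l}" using i(1) cs(1) by (simp add: chains_def)
  then have "del_at i u \<in> alternating_chains n (l - 1)" by (rule alternating_chains_del_at[OF u(2)])
  then show "cs' \<in> chains n (l - 1)"
    using ppart_chain_in_chains[OF n u(1)] i(2) u(3) by (metis map_del_at)
qed

lemma cycles_iff:
  fixes z :: "ppart list \<Rightarrow> 'k::comm_ring_1"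
  assumes n: "n \<ge> 1"
  shows "z \<in> cycles n l \<longleftrightarrow> supp_on (chains n l) z \<and>
    (\<forall>\<tau>. \<tau> permutes {1..n} \<longrightarrow> (\<forall>w. boundary (alternating_chains n l) (\<lambda>u. z (ppart_chain n \<tau> u)) w = 0))"
proof -
  have "bdry n l z = (\<lambda>_. 0) \<longleftrightarrow>
    (\<forall>\<tau>. \<tau> permutes {1..n} \<longrightarrow> (\<forall>w. boundary (alternating_chains n l) (\<lambda>u. z (ppart_chain n \<tau> u)) w = 0))"
    (is "?L \<longleftrightarrow> ?R")
  proof
    assume L: ?L
    show ?R
    proof (intro allI impI)
      fix \<tau> w assume \<tau>: "\<tau> permutes {1..n}"
      show "boundary (alternating_chains n l) (\<lambda>u. z (ppart_chain n \<tau> u)) w = 0"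
      proof (cases "w \<in> alternating_chains n (l - 1)")
        case True
        then show ?thesis using boundary_ppart_chain[OF n \<tau> True, of z] L by (simp add: bdry_eq_boundary)
      next
        case False
        then show ?thesis by (rule supp_on_0[OF boundary_alternating_chains_supp])
      qed
    qed
  next
    assume R: ?R
    have "boundary (chains n l) z cs = 0" for cs
    proof (cases "cs \<in> chains n (l - 1)")
      case True
      then obtain \<tau> u where "\<tau> permutes {1..n}" "u \<in> alternating_chains n (l - 1)" "cs = ppart_chain n \<tau> u"
        using chains_ppart_chain[OF n] by blast
      then show ?thesis using boundary_ppart_chain[OF n, of \<tau> u l z] R by simp
    next
      case False
      then show ?thesis by (rule supp_on_0[OF boundary_chains_supp[OF n]])
    qed
    then show ?L by (simp add: bdry_eq_boundary fun_eq_iff)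
  qed
  then show ?thesis by (auto simp: cycles_def chain_group_def supp_on_def)
qed

text \<open>The inverse of the splitting: a family of functions, one for each word, is glued by
  decoding a chain through \<open>chains_bij\<close>.\<close>

definition assemble :: "nat \<Rightarrow> nat \<Rightarrow> ((nat \<Rightarrow> nat) \<Rightarrow> nat set list \<Rightarrow> 'k::zero) \<Rightarrow> ppart list \<Rightarrow> 'k" where
  "assemble n l f cs = (if cs \<in> chains n l
     then let (\<tau>, u) = inv_into ({\<tau>. \<tau> permutes {1..n}} \<times> alternating_chains n l) (\<lambda>(\<tau>, u). ppart_chain n \<tau> u) cs in f \<tau> u
     else 0)"

lemma assemble_supp: "supp_on (chains n l) (assemble n l f)"
  by (simp add: supp_on_def assemble_def)

lemma assemble_eq:
  assumes "n \<ge> 1" "\<tau> permutes {1..n}" "u \<in> alternating_chains n l"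
  shows "assemble n l f (ppart_chain n \<tau> u) = f \<tau> u"
proof -
  have "inv_into ({\<tau>. \<tau> permutes {1..n}} \<times> alternating_chains n l) (\<lambda>(\<tau>, u). ppart_chain n \<tau> u)
      ((\<lambda>(\<tau>, u). ppart_chain n \<tau> u) (\<tau>, u)) = (\<tau>, u)"
    by (rule bij_betw_inv_into_left[OF chains_bij[OF assms(1)]]) (use assms in simp)
  then show ?thesis using ppart_chain_in_chains[OF assms] by (simp add: assemble_def)
qed

lemma cycles_eq_boundaries:
  assumes n: "n \<ge> 1" and l: "l \<noteq> n - 1"
  shows "(cycles n l :: (ppart list \<Rightarrow> 'k::comm_ring_1) set) = boundaries n l"
proof (intro equalityI subsetI)
  fix z :: "ppart list \<Rightarrow> 'k" assume z: "z \<in> cycles n l"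
  \<comment> \<open>The cutoff is needed for the support: a list \<open>u\<close> outside
    \<open>alternating_chains n l\<close> can give the same chain of partitions, for instance when 0
    is added to one of its sets.\<close>
  let ?z = "\<lambda>\<tau> u. if u \<in> alternating_chains n l then z (ppart_chain n \<tau> u) else 0"
  have "\<exists>y. supp_on (alternating_chains n (Suc l)) y \<and> boundary (alternating_chains n (Suc l)) y = ?z \<tau>" if \<tau>: "\<tau> permutes {1..n}" for \<tau>
  proof (rule alternating_chains_exact[OF n l])
    show "supp_on (alternating_chains n l) (?z \<tau>)" by (simp add: supp_on_def)
    have "boundary (alternating_chains n l) (?z \<tau>) = boundary (alternating_chains n l) (\<lambda>u. z (ppart_chain n \<tau> u))" by (rule boundary_cong) simp
    then show "boundary (alternating_chains n l) (?z \<tau>) w = 0" for w using z \<tau> unfolding cycles_iff[OF n] by simp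
  qed
  then obtain y where y: "\<And>\<tau>. \<tau> permutes {1..n} \<Longrightarrow> boundary (alternating_chains n (Suc l)) (y \<tau>) = ?z \<tau>" by metis
  let ?y = "assemble n (Suc l) y"
  have "boundary (chains n (Suc l)) ?y cs = z cs" for cs
  proof (cases "cs \<in> chains n l")
    case True
    then obtain \<tau> u where u: "\<tau> permutes {1..n}" "u \<in> alternating_chains n l" "cs = ppart_chain n \<tau> u"
      using chains_ppart_chain[OF n] by blast
    have "boundary (chains n (Suc l)) ?y cs = boundary (alternating_chains n (Suc l)) (\<lambda>u. ?y (ppart_chain n \<tau> u)) u"
      unfolding u(3) by (rule boundary_ppart_chain[OF n u(1)]) (use u(2) in simp)
    also have "\<dots> = boundary (alternating_chains n (Suc l)) (y \<tau>) u"
      using boundary_cong[of "alternating_chains n (Suc l)" "\<lambda>u. ?y (ppart_chain n \<tau> u)" "y \<tau>", OF assemble_eq[OF n u(1)]]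
      by (rule fun_cong)
    finally show ?thesis using y[OF u(1)] u by simp
  next
    case False
    have "boundary (chains n (Suc l)) ?y cs = 0"
      by (rule supp_on_0[OF boundary_chains_supp[OF n]]) (use False in simp)
    moreover have "z cs = 0" using z False unfolding cycles_iff[OF n] by (blast intro: supp_on_0)
    ultimately show ?thesis by simp
  qed
  then have "z = bdry n (Suc l) ?y" by (simp add: bdry_eq_boundary fun_eq_iff)
  moreover have "?y \<in> chain_group n (Suc l)"
    using assemble_supp[of n "Suc l" y] by (simp add: chain_group_def supp_on_def)
  ultimately show "z \<in> boundaries n l" unfolding boundaries_def by blast
next
  fix z :: "ppart list \<Rightarrow> 'k" assume "z \<in> boundaries n l"
  then obtain y where y: "z = boundary (chains n (Suc l)) y" unfolding boundaries_def bdry_eq_boundary by blast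
  have "supp_on (chains n l) z" unfolding y using boundary_chains_supp[OF n, of "Suc l"] by simp
  moreover have "boundary (alternating_chains n l) (\<lambda>u. z (ppart_chain n \<tau> u)) w = 0" if \<tau>: "\<tau> permutes {1..n}" for \<tau> w
  proof -
    have "boundary (alternating_chains n l) (\<lambda>u. z (ppart_chain n \<tau> u))
        = boundary (alternating_chains n l) (boundary (alternating_chains n (Suc l)) (\<lambda>u. y (ppart_chain n \<tau> u)))"
      by (rule boundary_cong) (use boundary_ppart_chain[OF n \<tau>, of _ "Suc l" y] y in simp)
    then show ?thesis by (simp add: boundary_boundary_alternating_chains)
  qed
  ultimately show "z \<in> cycles n l" unfolding cycles_iff[OF n] by blast
qed

section \<open>The isomorphism in the top degree\<close>

text \<open>There are no longer chains, so in the top degree homology is the module of cycles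
  itself.\<close>

lemma boundaries_top:
  assumes "n \<ge> 1"
  shows "(boundaries n (n - 1) :: (ppart list \<Rightarrow> 'k::comm_ring_1) set) = {\<lambda>_. 0}"
proof -
  have "chains n (Suc (n - 1)) = {}"
    using chains_ppart_chain[OF assms] alternating_chains_empty[OF assms, of "Suc (n - 1)"] by fastforce
  then have "bdry n (Suc (n - 1)) c = (\<lambda>_. 0 :: 'k)" for c by (simp add: bdry_def)
  moreover have "(\<lambda>_. 0) \<in> chain_group n (Suc (n - 1))" by (simp add: chain_group_def)
  ultimately show ?thesis unfolding boundaries_def by auto
qed

definition restrict_to_critical :: "nat \<Rightarrow> (ppart list \<Rightarrow> 'k::zero) \<Rightarrow> pbtree \<times> (nat \<Rightarrow> nat) \<Rightarrow> 'k" where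
  "restrict_to_critical n z = (\<lambda>(t, \<tau>). if t \<in> Y n \<and> \<tau> permutes {1..n} then z (ppart_chain n \<tau> (tree_chain n t)) else 0)"

lemma restrict_to_critical_inj:
  fixes z1 z2 :: "ppart list \<Rightarrow> 'k::comm_ring_1"
  assumes n: "n \<ge> 1" and z: "z1 \<in> cycles n (n - 1)" "z2 \<in> cycles n (n - 1)"
    and eq: "restrict_to_critical n z1 = restrict_to_critical n z2"
  shows "z1 = z2"
proof
  fix cs
  show "z1 cs = z2 cs"
  proof (cases "cs \<in> chains n (n - 1)")
    case False
    then have "z1 cs = 0" "z2 cs = 0" using z unfolding cycles_iff[OF n] by (blast intro: supp_on_0)+
    then show ?thesis by simp
  next
    case True
    then obtain \<tau> u where u: "\<tau> permutes {1..n}" "u \<in> alternating_chains n (n - 1)" "cs = ppart_chain n \<tau> u"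
      using chains_ppart_chain[OF n] by blast
    let ?d = "\<lambda>u. if u \<in> alternating_chains n (n - 1) then z1 (ppart_chain n \<tau> u) - z2 (ppart_chain n \<tau> u) else 0"
    have "?d u = 0"
    proof (rule alternating_chains_top_cycle_unique[OF n])
      show "supp_on (alternating_chains n (n - 1)) ?d" by (simp add: supp_on_def)
      have "boundary (alternating_chains n (n - 1)) ?d = boundary (alternating_chains n (n - 1)) (\<lambda>u. z1 (ppart_chain n \<tau> u) - z2 (ppart_chain n \<tau> u))"
        by (rule boundary_cong) simp
      then show "boundary (alternating_chains n (n - 1)) ?d w = 0" for w
        using z u(1) unfolding cycles_iff[OF n] by (simp add: boundary_diff)
      fix v assume "v \<in> critical_chains n"
      then obtain t where t: "t \<in> Y n" "v = tree_chain n t"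
        using tree_chain_bij[OF n] unfolding bij_betw_def by blast
      have "restrict_to_critical n z1 (t, \<tau>) = restrict_to_critical n z2 (t, \<tau>)" using eq by simp
      then show "?d v = 0" using t u(1) by (simp add: restrict_to_critical_def)
    qed
    then show ?thesis using u by simp
  qed
qed

text \<open>Choose for each word a cycle with the prescribed values on critical chains and glue
  these cycles.\<close>

lemma restrict_to_critical_image:
  assumes n: "n \<ge> 1"
  shows "restrict_to_critical n ` cycles n (n - 1) = (dend_module n :: (pbtree \<times> (nat \<Rightarrow> nat) \<Rightarrow> 'k::comm_ring_1) set)"
proof (intro equalityI subsetI)
  fix f :: "pbtree \<times> (nat \<Rightarrow> nat) \<Rightarrow> 'k" assume "f \<in> restrict_to_critical n ` cycles n (n - 1)"
  then show "f \<in> dend_module n" by (auto simp: dend_module_def restrict_to_critical_def split: if_splits)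
next
  fix f :: "pbtree \<times> (nat \<Rightarrow> nat) \<Rightarrow> 'k" assume f: "f \<in> dend_module n"
  let ?t = "inv_into (Y n) (tree_chain n)"
  have "\<exists>z. supp_on (alternating_chains n (n - 1)) z \<and> (\<forall>w. boundary (alternating_chains n (n - 1)) z w = 0) \<and> (\<forall>u\<in>critical_chains n. z u = f (?t u, \<tau>))" for \<tau>
    by (rule alternating_chains_top_cycle_exists[OF n])
  then obtain z where z: "\<And>\<tau> w. boundary (alternating_chains n (n - 1)) (z \<tau>) w = 0" "\<And>\<tau> u. u \<in> critical_chains n \<Longrightarrow> z \<tau> u = f (?t u, \<tau>)"
    by metis
  let ?z = "assemble n (n - 1) z"
  have "?z \<in> cycles n (n - 1)" unfolding cycles_iff[OF n]
  proof (intro conjI allI impI assemble_supp)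
    fix \<tau> w assume \<tau>: "\<tau> permutes {1..n}"
    have "boundary (alternating_chains n (n - 1)) (\<lambda>u. ?z (ppart_chain n \<tau> u)) = boundary (alternating_chains n (n - 1)) (z \<tau>)"
      by (rule boundary_cong) (rule assemble_eq[OF n \<tau>])
    then show "boundary (alternating_chains n (n - 1)) (\<lambda>u. ?z (ppart_chain n \<tau> u)) w = 0" using z(1) by simp
  qed
  moreover have "restrict_to_critical n ?z (t, \<tau>) = f (t, \<tau>)" for t \<tau>
  proof (cases "t \<in> Y n \<and> \<tau> permutes {1..n}")
    case True
    then have c: "tree_chain n t \<in> critical_chains n" "?t (tree_chain n t) = t"
      using tree_chain_bij[OF n] bij_betw_inv_into_left[OF tree_chain_bij[OF n]] by (auto simp: bij_betw_def)
    then have "?z (ppart_chain n \<tau> (tree_chain n t)) = z \<tau> (tree_chain n t)"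
      using True by (intro assemble_eq[OF n]) (auto simp: critical_chains_def)
    then show ?thesis using True z(2)[OF c(1)] c(2) by (simp add: restrict_to_critical_def)
  next
    case False
    then have "f (t, \<tau>) = 0" using f unfolding dend_module_def by force
    then show ?thesis using False by (auto simp: restrict_to_critical_def)
  qed
  then have "restrict_to_critical n ?z = f" by (simp add: fun_eq_iff)
  ultimately show "f \<in> restrict_to_critical n ` cycles n (n - 1)" by blast
qed

lemma restrict_to_critical_equivariant:
  assumes \<sigma>: "\<sigma> permutes {1..n}"
  shows "restrict_to_critical n (act_C \<sigma> z) = act_D \<sigma> (restrict_to_critical n z)"
proof -
  have i: "inv \<sigma> permutes {1..n}" by (rule permutes_inv[OF \<sigma>])
  \<comment> \<open>The action has to respect the cutoff in \<open>restrict_to_critical\<close>, by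
    which both sides are zero off the permutations.\<close>
  have "inv \<sigma> \<circ> \<tau> permutes {1..n} \<longleftrightarrow> \<tau> permutes {1..n}" for \<tau>
  proof
    assume "inv \<sigma> \<circ> \<tau> permutes {1..n}"
    then have "\<sigma> \<circ> (inv \<sigma> \<circ> \<tau>) permutes {1..n}" using \<sigma> by (rule permutes_compose)
    then show "\<tau> permutes {1..n}" using permutes_inv_o(1)[OF \<sigma>] by (simp add: comp_assoc[symmetric])
  qed (rule permutes_compose[OF _ i])
  then show ?thesis
    by (auto simp: fun_eq_iff restrict_to_critical_def act_C_def act_D_def perm_chain_ppart_chain)
qed

theorem mainTheorem11:
  fixes n l :: nat
  assumes "coeff_ring_ok TYPE('k::comm_ring_1)"
    and "n \<ge> 1"
  shows "(l = n - 1 \<longrightarrow>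
            homology_iso_to n l (dend_module n :: (pbtree \<times> (nat \<Rightarrow> nat) \<Rightarrow> 'k) set) act_D) \<and>
         (l \<noteq> n - 1 \<longrightarrow>
            (cycles n l :: (ppart list \<Rightarrow> 'k) set) = boundaries n l)"
proof (intro conjI impI)
  note n = assms(2)
  show "(cycles n l :: (ppart list \<Rightarrow> 'k) set) = boundaries n l" if "l \<noteq> n - 1"
    by (rule cycles_eq_boundaries[OF n that])
  assume l: "l = n - 1"
  show "homology_iso_to n l (dend_module n :: (pbtree \<times> (nat \<Rightarrow> nat) \<Rightarrow> 'k) set) act_D"
    unfolding homology_iso_to_def l
  proof (intro exI[of _ "restrict_to_critical n"] conjI ballI allI impI)
    show "restrict_to_critical n ` cycles n (n - 1) = (dend_module n :: (pbtree \<times> (nat \<Rightarrow> nat) \<Rightarrow> 'k) set)"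
      by (rule restrict_to_critical_image[OF n])
    show "restrict_to_critical n z1 = restrict_to_critical n z2 \<longleftrightarrow> (\<lambda>x. z1 x - z2 x) \<in> boundaries n (n - 1)"
      if "z1 \<in> cycles n (n - 1)" "z2 \<in> cycles n (n - 1)" for z1 z2 :: "ppart list \<Rightarrow> 'k"
    proof -
      have "(\<lambda>x. z1 x - z2 x) \<in> boundaries n (n - 1) \<longleftrightarrow> z1 = z2"
        unfolding boundaries_top[OF n] by (simp add: fun_eq_iff)
      then show ?thesis using restrict_to_critical_inj[OF n that] by blast
    qed
    show "restrict_to_critical n (act_C \<sigma> z) = act_D \<sigma> (restrict_to_critical n z)"
      if "\<sigma> permutes {1..n}" for \<sigma> and z :: "ppart list \<Rightarrow> 'k"
      using that by (rule restrict_to_critical_equivariant)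
  qed (auto simp: restrict_to_critical_def fun_eq_iff)
qed

end
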